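(* Let $p$ be a prime and let $(r,e,d)$ be integers such that both $(r,e,d)$ and $(r,e+1,d)$ lie in $\mathscr{B}_0(p)$ (so $d=r-1$), and put $n=p-1-e$. Then the entries of the matrices $B_r,Q_r,Z_{r,n},P_r$ (defined over $\mathbb{Q}$ below) can be reduced modulo $p$, $M_d(f(x)^e)$ is invertible, and, with these reductions, \[ M_d(f(x)^e)^{-1}\,M_d(f(x)^{e+1})=B_r\,Q_r\,Z_{r,n}\,P_r . \]
   Context: $\mathscr{B}_0(p)$ is the set of integer triples $(r,e,d)$ with $2\le r\le p+1$, $(p-1)/2<e\le p-1$, $r(p-1-e)\le p-1$, $d=r-1$. Let $f(x)=x^r+s_1x^{r-1}+\cdots+s_r=(x-x_1)\cdots(x-x_r)$ with $x_1,\dots,x_r$ independent indeterminates; over $\mathbb{F}_p$, for an integer $k\ge0$ write $f(x)^k=\sum_i c^{(k)}_ix^i$ ($c^{(k)}_i=0$ for $i<0$) and let $M_d(f(x)^k)$ be the $d\times d$ matrix with $(i,j)$ entry $c^{(k)}_{ip+j-d-1}$. The following matrices are defined with $x_1,\dots,x_r$ independent over $\mathbb{Q}$ (entries in $\mathbb{Q}[s_1,\dots,s_r]$). Let $\varphi(t)=1+s_1t+\cdots+s_rt^r$ and for $\lambda\in\mathbb{C}$, $\ell\in\mathbb{Z}$ let $\beta_\ell(\lambda)$ be the coefficient of $t^\ell$ in $\varphi(t)^\lambda$ (so $\beta_0=1$, $\beta_\ell=0$ for $\ell<0$). For polynomials $F,G$ with $D=\max(\deg F,\deg G)$, the Bézout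 matrix $\mathrm{Bez}(F,G)$ is the $D\times D$ matrix with $\frac{F(x)G(y)-F(y)G(x)}{x-y}=(1,x,\ldots,x^{D-1})\,\mathrm{Bez}(F,G)\,(1,y,\ldots,y^{D-1})^T$. Let $J$ be the $(r-1)\times(r-1)$ matrix with ones on the antidiagonal and zeros elsewhere. Define $(r-1)\times(r-1)$ matrices: $B_r=J\,\mathrm{Bez}\bigl(f'(x),\,f(x)-\tfrac1r xf'(x)\bigr)$; $Q_r$ with $(i,j)$ entry $\beta_{i-j}(-j/r)$; $Z_{r,n}=\mathrm{diag}(\zeta_1,\ldots,\zeta_{r-1})$ with $\zeta_i=\frac{n}{rn-(r-i)}$; $P_r$ with $(i,j)$ entry $\beta_{i-j}(-(r-i)/r)$. *)

theory Defs
  imports "HOL-Library.Poly_Mapping" "HOL-Computational_Algebra.Polynomial"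
    "HOL-Computational_Algebra.Fraction_Field"
    "Berlekamp_Zassenhaus.Finite_Field" "Jordan_Normal_Form.Determinant"
begin

text \<open>A multivariate polynomial over a coefficient ring 'a is a finitely supported map from
  monomials (nat =>0 nat, exponent of variable s_k at key k) to coefficients.\<close>

type_synonym 'a mpol = "(nat \<Rightarrow>\<^sub>0 nat) \<Rightarrow>\<^sub>0 'a"

definition mvar :: "nat \<Rightarrow> 'a::comm_ring_1 mpol" where
  "mvar k = Poly_Mapping.single (Poly_Mapping.single k 1) 1"

definition mconst :: "'a::comm_ring_1 \<Rightarrow> 'a mpol" where
  "mconst c = Poly_Mapping.single 0 c"

definition fpol :: "nat \<Rightarrow> 'a::comm_ring_1 mpol poly" where
  "fpol r = monom 1 r + (\<Sum>k\<in>{1..r}. monom (mvar k) (r - k))"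

definition Mmat :: "nat \<Rightarrow> nat \<Rightarrow> nat \<Rightarrow> ('p::prime_card mod_ring) mpol mat" where
  "Mmat r d k = mat d d (\<lambda>(i,j).
     (let idx = int ((i+1) * CARD('p) + (j+1)) - int d - 1
      in if idx < 0 then 0 else coeff ((fpol r) ^ k) (nat idx)))"

definition psi_pol :: "nat \<Rightarrow> rat mpol poly" where
  "psi_pol r = (\<Sum>k\<in>{1..r}. monom (mvar k) k)"

text \<open>beta_l(lambda): coefficient of t^l in phi(t)^lambda
  = sum_k (lambda choose k) (phi(t)-1)^k (binomial series; only k <= l contributes).\<close>
definition beta :: "nat \<Rightarrow> int \<Rightarrow> rat \<Rightarrow> rat mpol" where
  "beta r l lam = (if l < 0 then 0 else
     (\<Sum>k\<le>nat l. mconst (lam gchoose k) * coeff ((psi_pol r) ^ k) (nat l)))"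

text \<open>Bezout matrix: the D x D matrix B with
  (F(x)G(y) - F(y)G(x)) = (x - y) * sum_{i,j<D} B_ij x^i y^j, D = max(deg F, deg G).
  Bivariate polynomials: outer variable x, inner variable y.\<close>
definition bez_identity :: "'a::comm_ring_1 poly \<Rightarrow> 'a poly \<Rightarrow> 'a mat \<Rightarrow> bool" where
  "bez_identity F G B \<longleftrightarrow>
     (let D = max (degree F) (degree G);
          Fx = map_poly (\<lambda>c. [:c:]) F; Gx = map_poly (\<lambda>c. [:c:]) G;
          Fy = [:F:]; Gy = [:G:];
          X = [:0, 1:]; Y = [:[:0, 1:]:]
      in B \<in> carrier_mat D D \<and>
         Fx * Gy - Fy * Gx = (X - Y) * (\<Sum>i<D. \<Sum>j<D. monom (monom (B $$ (i,j)) j) i))"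

definition Bez :: "'a::comm_ring_1 poly \<Rightarrow> 'a poly \<Rightarrow> 'a mat" where
  "Bez F G = (THE B. bez_identity F G B)"

definition Jmat :: "nat \<Rightarrow> 'a::comm_ring_1 mat" where
  "Jmat m = mat m m (\<lambda>(i,j). if i + j + 1 = m then 1 else 0)"

text \<open>All matrices below are (r-1) x (r-1), indices 0-based (paper index = our index + 1).\<close>

definition Bmat :: "nat \<Rightarrow> rat mpol mat" where
  "Bmat r = Jmat (r - 1) *
     Bez (pderiv (fpol r)) (fpol r - smult (mconst (1 / of_nat r)) (monom 1 1 * pderiv (fpol r)))"

definition Qmat :: "nat \<Rightarrow> rat mpol mat" where
  "Qmat r = mat (r - 1) (r - 1) (\<lambda>(i,j). beta r (int i - int j) (- of_nat (j+1) / of_nat r))"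

definition Zmat :: "nat \<Rightarrow> int \<Rightarrow> rat mpol mat" where
  "Zmat r n = mat (r - 1) (r - 1) (\<lambda>(i,j). if i = j then
      mconst (of_int n / (of_nat r * of_int n - (of_nat r - of_nat (i+1)))) else 0)"

definition Pmat :: "nat \<Rightarrow> rat mpol mat" where
  "Pmat r = mat (r - 1) (r - 1) (\<lambda>(i,j). beta r (int i - int j) (- (of_nat r - of_nat (i+1)) / of_nat r))"

definition p_integral :: "int \<Rightarrow> rat \<Rightarrow> bool" where
  "p_integral p q \<longleftrightarrow> \<not> p dvd snd (quotient_of q)"

definition p_integral_mpol :: "int \<Rightarrow> rat mpol \<Rightarrow> bool" where
  "p_integral_mpol p a \<longleftrightarrow> (\<forall>m. p_integral p (Poly_Mapping.lookup a m))"

definition p_integral_mat :: "int \<Rightarrow> rat mpol mat \<Rightarrow> bool" where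
  "p_integral_mat p A \<longleftrightarrow> (\<forall>i<dim_row A. \<forall>j<dim_col A. p_integral_mpol p (A $$ (i,j)))"

definition red_rat :: "rat \<Rightarrow> 'p::prime_card mod_ring" where
  "red_rat q = (case quotient_of q of (a, b) \<Rightarrow> of_int a * inverse (of_int b))"

definition red_mpol :: "rat mpol \<Rightarrow> ('p::prime_card mod_ring) mpol" where
  "red_mpol a = Poly_Mapping.map red_rat a"

definition red_mat :: "rat mpol mat \<Rightarrow> ('p::prime_card mod_ring) mpol mat" where
  "red_mat A = map_mat red_mpol A"

definition to_fract_mat :: "('p::prime_card mod_ring) mpol mat \<Rightarrow> ('p mod_ring) mpol fract mat" where
  "to_fract_mat A = map_mat (\<lambda>a. Fract a 1) A"

definition B0 :: "int \<Rightarrow> (int \<times> int \<times> int) set" where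
  "B0 p = {(r, e, d). 2 \<le> r \<and> r \<le> p + 1 \<and> real_of_int (p - 1) / 2 < real_of_int e \<and> e \<le> p - 1
           \<and> r * (p - 1 - e) \<le> p - 1 \<and> d = r - 1}"

end

theory Submission
  imports Defs "HOL-Computational_Algebra.Polynomial_FPS"
begin

text \<open>
  Put \<open>m = r - 1\<close>. For each column \<open>j\<close> (counted from 1) there are a polynomial \<open>v\<close> and a remainder
  \<open>g = \<Sum>\<^sub>b R\<^sub>b\<^sub>j x\<^bsup>m-b\<^esup>\<close>, where \<open>R = B\<^sub>r Q\<^sub>r Z\<^sub>r\<^sub>,\<^sub>n P\<^sub>r\<close>, with
  \<open>x\<^bsup>m-j\<^esup> f = v' f - n v f' + g\<close>.
  This is the reduction of \<open>x\<^bsup>m-j\<^esup> f\<^bsup>-n\<^esup> dx\<close> to pole order \<open>n + 1\<close> modulo the exact form \<open>d(v f\<^bsup>-n\<^esup>)\<close>.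
  In the coordinate \<open>w = f\<^bsup>1/r\<^esup>\<close> at infinity, \<open>P\<^sub>r\<close> expands \<open>x\<^bsup>m-j\<^esup> dx\<close> in the forms \<open>w\<^bsup>m-i\<^esup> dw\<close>,
  \<open>Q\<^sub>r\<close> expands \<open>w\<^bsup>-i\<^esup>\<close> in the powers of \<open>1/x\<close>, the Bezout matrix computes the remainder belonging to
  the polynomial part of \<open>w\<^bsup>r-i\<^esup>\<close>, and \<open>Z\<^sub>r\<^sub>,\<^sub>n\<close> holds the constants from integrating \<open>w\<^bsup>m-i-rn\<^esup> dw\<close>,
  multiplied by \<open>-n\<close>.

  All coefficients are \<open>p\<close>-integral, and \<open>-n = e + 1\<close> modulo \<open>p\<close>, so after multiplication by \<open>f\<^sup>e\<close>
  the identity reads \<open>x\<^bsup>m-j\<^esup> f\<^bsup>e+1\<^esup> = (v f\<^bsup>e+1\<^esup>)' + g f\<^sup>e\<close>. A derivative has no term of exponent \<open>ip - 1\<close> in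
  characteristic \<open>p\<close>; comparing these coefficients gives \<open>M(f\<^bsup>e+1\<^esup>) = M(f\<^sup>e) R\<close>.
  Finally \<open>M(f\<^sup>e)\<close> is nonsingular because it becomes a monomial matrix for \<open>f = x\<^sup>r + 1\<close>.
\<close>

subsection \<open>Homomorphisms defined on a subring\<close>

text \<open>Reduction modulo \<open>p\<close> respects sums and products only on
  \<open>p\<close>-integral arguments, so the homomorphism laws are restricted to a subring
  \<open>S\<close>; nothing is claimed about \<open>h\<close> outside it.\<close>

locale subring_hom =
  fixes S :: "'a::idom set" and h :: "'a \<Rightarrow> 'b::idom"
  assumes one_mem: "1 \<in> S"
    and add_mem: "x \<in> S \<Longrightarrow> y \<in> S \<Longrightarrow> x + y \<in> S"
    and uminus_mem: "x \<in> S \<Longrightarrow> - x \<in> S"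
    and mult_mem: "x \<in> S \<Longrightarrow> y \<in> S \<Longrightarrow> x * y \<in> S"
    and h_one: "h 1 = 1"
    and h_add: "x \<in> S \<Longrightarrow> y \<in> S \<Longrightarrow> h (x + y) = h x + h y"
    and h_mult: "x \<in> S \<Longrightarrow> y \<in> S \<Longrightarrow> h (x * y) = h x * h y"
begin

lemma zero_mem: "0 \<in> S"
  using add_mem[OF one_mem uminus_mem[OF one_mem]] by simp

lemma h_zero: "h 0 = 0"
  using h_add[OF zero_mem zero_mem] by (metis add.right_neutral add_left_cancel)

lemma h_uminus: "x \<in> S \<Longrightarrow> h (- x) = - h x"
  using h_add[of x "- x"] uminus_mem[of x] h_zero by (simp add: eq_neg_iff_add_eq_0 add.commute)

lemma diff_mem: "x \<in> S \<Longrightarrow> y \<in> S \<Longrightarrow> x - y \<in> S"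
  using add_mem[of x "- y"] uminus_mem[of y] by simp

lemma h_diff: "x \<in> S \<Longrightarrow> y \<in> S \<Longrightarrow> h (x - y) = h x - h y"
  using h_add[of x "- y"] uminus_mem[of y] h_uminus[of y] by simp

lemma sum_mem: "(\<And>i. i \<in> A \<Longrightarrow> f i \<in> S) \<Longrightarrow> sum f A \<in> S"
  by (induction A rule: infinite_finite_induct) (auto intro: zero_mem add_mem)

lemma h_sum: "(\<And>i. i \<in> A \<Longrightarrow> f i \<in> S) \<Longrightarrow> h (sum f A) = (\<Sum>i\<in>A. h (f i))"
  by (induction A rule: infinite_finite_induct) (auto simp: h_zero h_add sum_mem)

lemma prod_mem: "(\<And>i. i \<in> A \<Longrightarrow> f i \<in> S) \<Longrightarrow> prod f A \<in> S"
  by (induction A rule: infinite_finite_induct) (auto intro: one_mem mult_mem)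

lemma power_mem: "x \<in> S \<Longrightarrow> x ^ k \<in> S"
  by (induction k) (auto intro: one_mem mult_mem)

lemma of_nat_mem: "of_nat k \<in> S"
  by (induction k) (auto intro: zero_mem one_mem add_mem)

lemma of_int_mem: "of_int k \<in> S"
  by (cases k rule: int_cases2) (auto intro!: uminus_mem of_nat_mem)

lemma h_of_nat: "h (of_nat k) = of_nat k"
  by (induction k) (auto simp: h_zero h_one h_add one_mem of_nat_mem)

lemma h_of_int: "h (of_int k) = of_int k"
  by (cases k rule: int_cases2) (auto simp: h_of_nat h_uminus of_nat_mem)

text \<open>The coefficientwise extension obeys the same laws, so whole polynomial identities can be
  transported at once.\<close>

lemma subring_hom_poly: "subring_hom {q. \<forall>i. coeff q i \<in> S} (map_poly h)"
proof
  have c: "coeff (map_poly h q) i = h (coeff q i)" for q i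
    by (simp add: coeff_map_poly h_zero)
  show "1 \<in> {q. \<forall>i. coeff q i \<in> S}"
    by (auto simp: coeff_1 zero_mem one_mem)
  show "map_poly h 1 = 1"
    by (auto simp: poly_eq_iff c coeff_1 h_zero h_one)
  fix x y assume x: "x \<in> {q. \<forall>i. coeff q i \<in> S}"
  show "- x \<in> {q. \<forall>i. coeff q i \<in> S}"
    using x by (auto intro: uminus_mem)
  assume y: "y \<in> {q. \<forall>i. coeff q i \<in> S}"
  show "x + y \<in> {q. \<forall>i. coeff q i \<in> S}" "x * y \<in> {q. \<forall>i. coeff q i \<in> S}"
    using x y by (auto simp: coeff_mult intro!: add_mem sum_mem mult_mem)
  show "map_poly h (x + y) = map_poly h x + map_poly h y"
       "map_poly h (x * y) = map_poly h x * map_poly h y"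
    using x y by (auto simp: poly_eq_iff c coeff_mult h_add h_sum h_mult mult_mem)
qed

lemma map_poly_pderiv:
  assumes "\<And>i. coeff q i \<in> S"
  shows "map_poly h (pderiv q) = pderiv (map_poly h q)"
  using assms
  by (simp add: poly_eq_iff coeff_map_poly h_zero coeff_pderiv h_mult h_of_nat of_nat_mem
      h_add one_mem h_one add_mem)

lemma mult_mat_mem:
  assumes "A \<in> carrier_mat n m" "B \<in> carrier_mat m l"
    and "\<And>i j. i < n \<Longrightarrow> j < m \<Longrightarrow> A $$ (i,j) \<in> S" "\<And>i j. i < m \<Longrightarrow> j < l \<Longrightarrow> B $$ (i,j) \<in> S"
    and "i < n" "j < l"
  shows "(A * B) $$ (i,j) \<in> S"
  using assms by (auto simp: scalar_prod_def intro!: sum_mem mult_mem)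

lemma map_mat_mult:
  assumes "A \<in> carrier_mat n m" "B \<in> carrier_mat m l"
    and "\<And>i j. i < n \<Longrightarrow> j < m \<Longrightarrow> A $$ (i,j) \<in> S" "\<And>i j. i < m \<Longrightarrow> j < l \<Longrightarrow> B $$ (i,j) \<in> S"
  shows "map_mat h (A * B) = map_mat h A * map_mat h B"
  proof (rule eq_matI)
  fix i j assume "i < dim_row (map_mat h A * map_mat h B)" "j < dim_col (map_mat h A * map_mat h B)"
  then have ij: "i < n" "j < l"
    using assms by auto
  then have "h (\<Sum>k = 0..<m. A $$ (i, k) * B $$ (k, j)) = (\<Sum>k = 0..<m. h (A $$ (i, k)) * h (B $$ (k, j)))"
    using assms by (subst h_sum) (auto intro!: sum.cong simp: h_mult mult_mem)
  then show "map_mat h (A * B) $$ (i,j) = (map_mat h A * map_mat h B) $$ (i,j)"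
    using ij assms by (auto simp: scalar_prod_def)
qed (use assms in auto)

end

section \<open>Multiplicative maps on multivariate polynomials\<close>

lemma poly_mapping_eq_sum_single: "a = (\<Sum>m\<in>Poly_Mapping.keys a. Poly_Mapping.single m (Poly_Mapping.lookup a m))"
  by (rule poly_mapping_eqI)
     (auto simp: lookup_sum lookup_single when_def not_in_keys_iff_lookup_eq_zero)

context
  fixes S :: "'a::comm_ring_1 set"
    and H :: "('m::comm_monoid_add \<Rightarrow>\<^sub>0 'a) \<Rightarrow> 'c::comm_ring_1"
  assumes zero: "0 \<in> S"
    and add: "\<And>x y. x \<in> S \<Longrightarrow> y \<in> S \<Longrightarrow> x + y \<in> S"
    and mult: "\<And>x y. x \<in> S \<Longrightarrow> y \<in> S \<Longrightarrow> x * y \<in> S"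
begin

lemma lookup_mult_mem:
  assumes "\<And>m. Poly_Mapping.lookup a m \<in> S" "\<And>m. Poly_Mapping.lookup b m \<in> S"
  shows "Poly_Mapping.lookup (a * b) m \<in> S"
proof -
  have sum: "(\<And>i. i \<in> A \<Longrightarrow> f i \<in> S) \<Longrightarrow> sum f A \<in> S" for A and f :: "'i \<Rightarrow> 'a"
    by (induction A rule: infinite_finite_induct) (auto intro: zero add)
  have "a * b = (\<Sum>k\<in>Poly_Mapping.keys a. \<Sum>l\<in>Poly_Mapping.keys b. Poly_Mapping.single (k + l) (Poly_Mapping.lookup a k * Poly_Mapping.lookup b l))"
    by (subst poly_mapping_eq_sum_single[of a], subst poly_mapping_eq_sum_single[of b])
       (simp add: sum_product mult_single)
  then show ?thesis
    using assms
    by (auto simp: lookup_sum lookup_single when_def intro!: sum mult zero)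
qed

text \<open>Both sides are biadditive, so splitting the factors into monomials reduces the claim to
  \<open>H_single\<close>. It serves twice: for coefficientwise reduction and, with
  \<open>S = UNIV\<close>, for the specialization \<open>eval_last\<close>.\<close>

lemma poly_mapping_hom_mult:
  assumes H_add: "\<And>a b. (\<And>m. Poly_Mapping.lookup a m \<in> S) \<Longrightarrow> (\<And>m. Poly_Mapping.lookup b m \<in> S) \<Longrightarrow> H (a + b) = H a + H b"
    and H_single: "\<And>k l x y. x \<in> S \<Longrightarrow> y \<in> S \<Longrightarrow>
      H (Poly_Mapping.single (k + l) (x * y)) = H (Poly_Mapping.single k x) * H (Poly_Mapping.single l y)"
    and a: "\<And>m. Poly_Mapping.lookup a m \<in> S" and b: "\<And>m. Poly_Mapping.lookup b m \<in> S"
  shows "H (a * b) = H a * H b"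
proof -
  let ?T = "{a. \<forall>m. Poly_Mapping.lookup a m \<in> S}"
  have H0: "H 0 = 0"
    using H_add[of 0 0] zero by simp
  have T_sum: "(\<And>i. i \<in> A \<Longrightarrow> f i \<in> ?T) \<Longrightarrow> sum f A \<in> ?T" for A and f :: "'m \<Rightarrow> _"
    by (induction A rule: infinite_finite_induct) (auto simp: zero lookup_add add)
  have H_sum: "(\<And>i. i \<in> A \<Longrightarrow> f i \<in> ?T) \<Longrightarrow> H (sum f A) = (\<Sum>i\<in>A. H (f i))" for A and f :: "'m \<Rightarrow> _"
  proof (induction A rule: infinite_finite_induct)
    case (insert x A)
    then show ?case
      using T_sum[of A f] H_add[of "f x" "sum f A"] by auto
  qed (auto simp: H0)
  have single_T: "x \<in> S \<Longrightarrow> Poly_Mapping.single k x \<in> ?T" for k x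
    by (auto simp: lookup_single when_def zero)
  have ex: "H a = (\<Sum>m\<in>Poly_Mapping.keys a. H (Poly_Mapping.single m (Poly_Mapping.lookup a m)))" if "\<And>m. Poly_Mapping.lookup a m \<in> S" for a
    using that by (subst poly_mapping_eq_sum_single[of a], subst H_sum)
      (auto simp: lookup_single when_def zero)
  have "a * b = (\<Sum>k\<in>Poly_Mapping.keys a. \<Sum>l\<in>Poly_Mapping.keys b. Poly_Mapping.single (k + l) (Poly_Mapping.lookup a k * Poly_Mapping.lookup b l))"
    by (subst poly_mapping_eq_sum_single[of a], subst poly_mapping_eq_sum_single[of b])
       (simp add: sum_product mult_single)
  also have "H \<dots> = (\<Sum>k\<in>Poly_Mapping.keys a. \<Sum>l\<in>Poly_Mapping.keys b. H (Poly_Mapping.single (k + l) (Poly_Mapping.lookup a k * Poly_Mapping.lookup b l)))"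
    by (subst H_sum, rule T_sum, rule single_T)
       (auto intro!: mult a b H_sum single_T sum.cong simp del: mem_Collect_eq)
  also have "\<dots> = H a * H b"
    by (simp add: ex a b sum_product H_single)
  finally show ?thesis .
qed

end

lemma (in subring_hom) subring_hom_poly_mapping:
  "subring_hom {a :: 'm::{ordered_cancel_comm_monoid_add, linorder} \<Rightarrow>\<^sub>0 'a. \<forall>m. Poly_Mapping.lookup a m \<in> S} (Poly_Mapping.map h)"
proof
  let ?T = "{a :: 'm \<Rightarrow>\<^sub>0 'a. \<forall>m. Poly_Mapping.lookup a m \<in> S}"
  \<comment> \<open>\<open>Poly_Mapping.map\<close> applies \<open>h\<close> to nonzero coefficients
    only; \<open>h 0 = 0\<close> makes this agree with applying it everywhere.\<close>
  have l: "Poly_Mapping.lookup (Poly_Mapping.map h a) m = h (Poly_Mapping.lookup a m)" for a :: "'m \<Rightarrow>\<^sub>0 'a" and m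
    by (simp add: Poly_Mapping.map.rep_eq when_def h_zero)
  have s: "Poly_Mapping.map h (Poly_Mapping.single k x) = Poly_Mapping.single k (h x)" for k :: 'm and x
    by (rule poly_mapping_eqI) (simp add: l lookup_single when_def h_zero)
  show "1 \<in> ?T"
    by (auto simp: lookup_one when_def zero_mem one_mem)
  show "Poly_Mapping.map h 1 = (1 :: 'm \<Rightarrow>\<^sub>0 'b)"
    by (rule poly_mapping_eqI) (auto simp: l lookup_one when_def h_zero h_one)
  fix x y assume x: "x \<in> ?T"
  show "- x \<in> ?T" using x by (auto intro: uminus_mem)
  assume y: "y \<in> ?T"
  show "x + y \<in> ?T" using x y by (auto simp: lookup_add intro: add_mem)
  show "x * y \<in> ?T" using x y by (auto intro!: lookup_mult_mem zero_mem add_mem mult_mem)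
  show "Poly_Mapping.map h (x + y) = Poly_Mapping.map h x + Poly_Mapping.map h y"
    using x y by (intro poly_mapping_eqI) (auto simp: l lookup_add h_add)
  show "Poly_Mapping.map h (x * y) = Poly_Mapping.map h x * Poly_Mapping.map h y"
    by (rule poly_mapping_hom_mult[where S = S])
       (use x y in \<open>auto intro!: poly_mapping_eqI zero_mem add_mem mult_mem
          simp: l lookup_add h_add s mult_single h_mult\<close>)
qed

subsection \<open>Powers of the series phi\<close>

lemma mconst_0: "mconst 0 = 0" and mconst_1: "mconst 1 = 1"
  by (simp_all add: mconst_def)

lemma mconst_add: "mconst (a + b) = mconst a + mconst b"
  by (simp add: mconst_def single_add)

lemma mconst_mult: "mconst (a * b) = mconst a * mconst b"
  by (simp add: mconst_def mult_single)

lemma mconst_uminus: "mconst (- a) = - mconst a"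
  by (simp add: mconst_def single_uminus)

lemma mconst_diff: "mconst (a - b) = mconst a - mconst b"
  by (simp add: mconst_def single_diff)

lemma mconst_sum: "mconst (sum f A) = (\<Sum>x\<in>A. mconst (f x))"
  by (induction A rule: infinite_finite_induct) (simp_all add: mconst_0 mconst_add)

lemma mconst_of_nat: "mconst (of_nat k) = of_nat k"
  by (simp add: mconst_def)

lemma mconst_of_int: "mconst (of_int k) = of_int k"
  by (simp add: mconst_def)

definition binomial_fps :: "rat \<Rightarrow> rat mpol fps" where
  "binomial_fps lam = Abs_fps (\<lambda>k. mconst (lam gchoose k))"

text \<open>\<open>phi^lam\<close> with \<open>phi = 1 + psi\<close>, written as a composition so
  that the exponent law and the chain rule come from the binomial series; \<open>beta\<close> lists
  its coefficients.\<close>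

definition phi_powr :: "nat \<Rightarrow> rat \<Rightarrow> rat mpol fps" where
  "phi_powr r lam = binomial_fps lam oo fps_of_poly (psi_pol r)"

abbreviation phi_coeff :: "nat \<Rightarrow> rat \<Rightarrow> nat \<Rightarrow> rat mpol" where
  "phi_coeff r lam \<equiv> fps_nth (phi_powr r lam)"

lemma coeff_psi_pol: "coeff (psi_pol r) l = (if 1 \<le> l \<and> l \<le> r then mvar l else 0)"
  by (simp add: psi_pol_def coeff_sum)

lemma binomial_fps_add: "binomial_fps (a + b) = binomial_fps a * binomial_fps b"
  by (rule fps_ext)
     (simp add: binomial_fps_def fps_mult_nth mconst_mult[symmetric] mconst_sum[symmetric]
       gbinomial_Vandermonde[symmetric] atLeast0AtMost)

lemma fps_deriv_binomial_fps:
  "fps_deriv (binomial_fps a) = fps_const (mconst a) * binomial_fps (a - 1)"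
proof (rule fps_ext)
  fix k
  have "of_nat (Suc k) * (a gchoose Suc k) = a * (a - 1 gchoose k)"
    by (rule gbinomial_absorption)
  from arg_cong[OF this, of mconst]
  show "fps_nth (fps_deriv (binomial_fps a)) k = fps_nth (fps_const (mconst a) * binomial_fps (a - 1)) k"
    by (simp add: binomial_fps_def mconst_mult mconst_of_nat del: of_nat_Suc)
qed

lemma psi_fps_nth_0: "fps_nth (fps_of_poly (psi_pol r)) 0 = 0"
  by (simp only: fps_of_poly_nth coeff_psi_pol) simp

lemma phi_powr_add: "phi_powr r (a + b) = phi_powr r a * phi_powr r b"
  unfolding phi_powr_def binomial_fps_add
  by (rule fps_compose_mult_distrib[OF psi_fps_nth_0])

lemma phi_powr_0: "phi_powr r 0 = 1"
proof -
  have "binomial_fps 0 = 1"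
    by (rule fps_ext) (auto simp: binomial_fps_def gbinomial_0_left mconst_0 mconst_1)
  then show ?thesis
    by (simp add: phi_powr_def)
qed

lemma fps_deriv_phi_powr:
  "fps_deriv (phi_powr r a) =
     fps_const (mconst a) * phi_powr r (a - 1) * fps_deriv (fps_of_poly (psi_pol r))"
  unfolding phi_powr_def fps_compose_deriv[OF psi_fps_nth_0] fps_deriv_binomial_fps
    fps_compose_mult_distrib[OF psi_fps_nth_0] fps_const_compose ..

lemma beta_nat: "beta r (int l) lam = phi_coeff r lam l"
  by (simp add: beta_def phi_powr_def fps_compose_nth binomial_fps_def atLeast0AtMost
      fps_of_poly_power[symmetric] del: fps_of_poly_power)

lemma beta_neg: "l < 0 \<Longrightarrow> beta r l lam = 0"
  by (simp add: beta_def)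

lemma beta_diff: "beta r (int i - int j) lam = (if j \<le> i then phi_coeff r lam (i - j) else 0)"
  using beta_nat[of r "i - j" lam] beta_neg[of "int i - int j" r lam] by (auto simp: of_nat_diff)

lemma phi_powr_1: "phi_coeff r 1 l = (if l = 0 then 1 else if l \<le> r then mvar l else 0)"
proof -
  have "binomial_fps 1 = 1 + fps_X"
  proof (rule fps_ext)
    fix k
    have "(1::rat) gchoose k = of_nat (1 choose k)"
      by (metis binomial_gbinomial of_nat_1)
    then show "fps_nth (binomial_fps 1) k = fps_nth (1 + fps_X) k"
      by (auto simp: binomial_fps_def mconst_of_nat binomial_eq_0 fps_X_def)
  qed
  then have "phi_powr r 1 = 1 + fps_of_poly (psi_pol r)"
    by (simp add: phi_powr_def fps_compose_add_distrib fps_X_fps_compose_startby0[OF psi_fps_nth_0])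
  then show ?thesis
    by (auto simp: coeff_psi_pol)
qed

lemma coeff_fpol:
  "coeff (fpol r) m = (if m = r then 1 else if m < r then mvar (r - m) else 0)"
proof -
  have "(\<Sum>k\<in>{1..r}. if r - k = m then mvar k else 0) =
        (\<Sum>k\<in>{1..r}. if k = r - m then (if m < r then mvar (r - m) else 0) else 0)"
    by (rule sum.cong) auto
  then show ?thesis
    by (auto simp: fpol_def coeff_sum)
qed

text \<open>This is \<open>f(x) = x^r phi(1/x)\<close>. Hence \<open>w = f^(1/r)\<close> equals
  \<open>x phi(1/x)^(1/r)\<close>, and expanding a power of \<open>w\<close> at infinity means
  expanding a power of \<open>phi\<close>.\<close>

lemma coeff_fpol_eq: "m \<le> r \<Longrightarrow> coeff (fpol r) m = phi_coeff r 1 (r - m)"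
  by (auto simp: coeff_fpol phi_powr_1)

lemma phi_powr_convolution:
  "(\<Sum>k\<le>N. phi_coeff r a k * phi_coeff r b (N - k)) = phi_coeff r (a + b) N"
  by (simp add: phi_powr_add fps_mult_nth atLeast0AtMost)

text \<open>The sum is a coefficient of \<open>t (phi^a)' phi^b\<close>. Since
  \<open>(phi^a)' phi^b = a phi^(a+b-1) phi'\<close>, this series is \<open>a/(a+b)\<close> times
  \<open>t (phi^(a+b))'\<close>.\<close>

lemma phi_powr_weighted_convolution:
  assumes "a + b \<noteq> 0"
  shows "(\<Sum>k\<le>N. of_nat k * (phi_coeff r a k * phi_coeff r b (N - k))) =
    mconst (a / (a + b) * of_nat N) * phi_coeff r (a + b) N"
proof -
  let ?X = "phi_powr r (a + b - 1) * fps_deriv (fps_of_poly (psi_pol r))"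
  have nth: "fps_nth (fps_X * fps_deriv f) k = of_nat k * fps_nth f k" for f :: "rat mpol fps" and k
    by (cases k) simp_all
  have "phi_powr r (a - 1) * phi_powr r b = phi_powr r (a + b - 1)"
    using phi_powr_add[of r "a - 1" b] by (simp only: diff_add_eq)
  moreover have "x * (c * A * D) * B = x * (c * ((A * B) * D))" for x c A B D :: "rat mpol fps"
    by (simp only: mult_ac)
  ultimately have "fps_X * fps_deriv (phi_powr r a) * phi_powr r b = fps_X * (fps_const (mconst a) * ?X)"
    unfolding fps_deriv_phi_powr by simp
  also have "mconst a = mconst (a / (a + b)) * mconst (a + b)"
    using assms by (simp add: mconst_mult[symmetric])
  also have "x * (fps_const (s * t) * (A * D)) = fps_const s * (x * (fps_const t * A * D))"
    for x A D :: "rat mpol fps" and s t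
    by (simp only: fps_const_mult[symmetric] mult_ac)
  then have "fps_X * (fps_const (mconst (a / (a + b)) * mconst (a + b)) * ?X) =
      fps_const (mconst (a / (a + b))) * (fps_X * fps_deriv (phi_powr r (a + b)))"
    by (simp only: fps_deriv_phi_powr)
  finally have X: "fps_X * fps_deriv (phi_powr r a) * phi_powr r b =
      fps_const (mconst (a / (a + b))) * (fps_X * fps_deriv (phi_powr r (a + b)))" .
  have "(\<Sum>k\<le>N. of_nat k * (phi_coeff r a k * phi_coeff r b (N - k))) =
        fps_nth (fps_X * fps_deriv (phi_powr r a) * phi_powr r b) N"
    by (subst fps_mult_nth) (simp only: nth atLeast0AtMost mult.assoc)
  also have "\<dots> = mconst (a / (a + b) * of_nat N) * phi_coeff r (a + b) N"
    unfolding X by (simp only: fps_mult_left_const_nth nth mconst_mult mconst_of_nat mult.assoc)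
  finally show ?thesis .
qed

subsection \<open>The matrix P and expansions at infinity\<close>

text \<open>A right inverse makes \<open>det A\<close> a unit with inverse \<open>det B\<close>, and
  the adjugate equals \<open>det A\<close> times \<open>B\<close>; cancelling \<open>det A\<close>
  in the adjugate identity gives the other order. The argument works over a ring, as entries in
  \<open>rat mpol\<close> demand.\<close>

lemma mat_left_inverse_if_right_inverse:
  fixes A B :: "'a::comm_ring_1 mat"
  assumes A: "A \<in> carrier_mat n n" and B: "B \<in> carrier_mat n n" and AB: "A * B = 1\<^sub>m n"
  shows "B * A = 1\<^sub>m n"
proof -
  note adj = adj_mat[OF A]
  have det: "det B * det A = 1"
    using det_mult[OF A B] AB by (simp add: mult.commute)
  have "adj_mat A = adj_mat A * (A * B)"
    using adj(1) AB by simp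
  also have "\<dots> = det A \<cdot>\<^sub>m B"
    using adj A B
    by (simp add: assoc_mult_mat[symmetric, of _ n n _ n _ n] mult_smult_assoc_mat[of "1\<^sub>m n" n n B n])
  finally have "det A \<cdot>\<^sub>m (B * A) = det A \<cdot>\<^sub>m 1\<^sub>m n"
    using adj(3) A B by (simp add: mult_smult_assoc_mat[of _ n n _ n])
  then have "det B \<cdot>\<^sub>m (det A \<cdot>\<^sub>m (B * A)) = det B \<cdot>\<^sub>m (det A \<cdot>\<^sub>m 1\<^sub>m n)"
    by simp
  moreover have "det B \<cdot>\<^sub>m (det A \<cdot>\<^sub>m M) = M" for M :: "'a mat"
    using det by (intro eq_matI) (auto simp: mult.assoc[symmetric])
  ultimately show ?thesis
    by simp
qed

text \<open>
  \<open>Vmat r\<close> holds the coefficients of \<open>v\<^sub>i' / (r - 1 - i)\<close>, where \<open>v\<^sub>i\<close> (\<open>vpol r i\<close> below) is the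
  polynomial part of \<open>w\<^bsup>r-1-i\<^esup>\<close>, with \<open>i\<close> counted from 0. That \<open>Pmat r\<close> is its inverse is Lagrange inversion;
  \<open>Pmat r * Vmat r\<close> is the easier order, since there every entry is a single convolution.
\<close>

definition Vmat :: "nat \<Rightarrow> rat mpol mat" where
  "Vmat r = mat (r - 1) (r - 1) (\<lambda>(l,i). if i \<le> l then
     mconst (of_nat (r - 1 - l) / of_nat (r - 1 - i)) * phi_coeff r (of_nat (r - 1 - i) / of_nat r) (l - i)
     else 0)"

lemma Pmat_index:
  assumes "a < r - 1" "l < r - 1"
  shows "Pmat r $$ (a,l) =
    (if l \<le> a then phi_coeff r (- of_nat (r - 1 - a) / of_nat r) (a - l) else 0)"
  using assms by (simp add: Pmat_def beta_diff of_nat_diff)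

lemma Pmat_Vmat: "Pmat r * Vmat r = 1\<^sub>m (r - 1)"
proof (rule eq_matI)
  fix a i assume "a < dim_row (1\<^sub>m (r - 1) :: rat mpol mat)" "i < dim_col (1\<^sub>m (r - 1) :: rat mpol mat)"
  then have a: "a < r - 1" and i: "i < r - 1" by auto
  let ?t = "\<lambda>l. Pmat r $$ (a,l) * Vmat r $$ (l,i)"
  have "(Pmat r * Vmat r) $$ (a,i) = (\<Sum>l<r-1. ?t l)"
    using a i by (simp add: Pmat_def Vmat_def scalar_prod_def lessThan_atLeast0)
  also have "\<dots> = (if a = i then 1 else 0)"
  proof (cases "i \<le> a")
    case False
    then show ?thesis
      using a i by (auto intro!: sum.neutral simp: Vmat_def Pmat_index)
  next
    case True
    define N where "N = a - i"
    define c :: rat where "c = of_nat (r - 1 - i)"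
    define la where "la = - of_nat (r - 1 - a) / (of_nat r :: rat)"
    define mu where "mu = c / of_nat r"
    have c: "c > 0"
      using i by (simp add: c_def)
    have r: "(of_nat r :: rat) > 0"
      using i by simp
    have Nc: "of_nat N = c - of_nat (r - 1 - a)"
      using a True by (simp add: c_def N_def of_nat_diff)
    then have sum: "mu + la = of_nat N / of_nat r"
      by (simp add: mu_def la_def diff_divide_distrib)
    have "(\<Sum>l<r-1. ?t l) = (\<Sum>l\<in>{i..a}. ?t l)"
      using a i by (intro sum.mono_neutral_right) (auto simp: Vmat_def Pmat_index)
    \<comment> \<open>With \<open>s = l - i\<close> the weight \<open>(r-1-l)/(r-1-i)\<close> from
      \<open>Vmat\<close> is \<open>1 - s/c\<close>, which is linear in \<open>s\<close>; so a plain
      and a weighted convolution suffice.\<close>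
    also have "\<dots> = (\<Sum>s\<le>N. mconst (1 - of_nat s / c) * (phi_coeff r mu s * phi_coeff r la (N - s)))"
    proof (rule sum.reindex_bij_witness[of _ "\<lambda>s. s + i" "\<lambda>l. l - i"])
      fix l assume l: "l \<in> {i..a}"
      then have "r - 1 - i = (r - 1 - l) + (l - i)"
        using a by auto
      then have "(of_nat (r - 1 - l) :: rat) = c - of_nat (l - i)"
        by (simp add: c_def del: of_nat_diff)
      then have "of_nat (r - 1 - l) / c = 1 - of_nat (l - i) / c"
        using c by (simp add: diff_divide_distrib)
      moreover have "N - (l - i) = a - l"
        using l by (auto simp: N_def)
      ultimately show "mconst (1 - of_nat (l - i) / c) * (phi_coeff r mu (l - i) * phi_coeff r la (N - (l - i))) = ?t l"
        using l a i by (simp add: Pmat_index Vmat_def la_def mu_def c_def mult_ac del: of_nat_diff)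
    qed (use True in \<open>auto simp: N_def\<close>)
    also have "\<dots> = (\<Sum>s\<le>N. phi_coeff r mu s * phi_coeff r la (N - s)) -
      mconst (1 / c) * (\<Sum>s\<le>N. of_nat s * (phi_coeff r mu s * phi_coeff r la (N - s)))"
    proof -
      have "mconst (1 - of_nat s / c) = 1 - mconst (1 / c) * of_nat s" for s
        by (simp add: mconst_of_nat[symmetric] mconst_mult[symmetric] mconst_1[symmetric]
            mconst_diff[symmetric] del: mconst_1)
      then show ?thesis
        by (simp only: left_diff_distrib mult_1_left sum_subtractf sum_distrib_left mult.assoc)
    qed
    \<comment> \<open>On the diagonal \<open>mu + la = 0\<close>, which the weighted convolution
      excludes; there \<open>N = 0\<close> and only the term \<open>s = 0\<close> is left.\<close>
    also have "\<dots> = (if a = i then 1 else 0)"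
    proof (cases "a = i")
      case True
      then show ?thesis
        using sum phi_powr_convolution[of r mu la 0] by (simp add: N_def phi_powr_0)
    next
      case False
      then have N: "N > 0"
        using True by (simp add: N_def)
      \<comment> \<open>Off the diagonal \<open>mu / (mu + la) = c / N\<close>, so the weighted
        convolution cancels the plain one exactly.\<close>
      then have "1 / c * (mu / (mu + la) * of_nat N) = 1"
        using c r by (simp add: sum) (simp add: mu_def)
      then have "mconst (1 / c) * mconst (mu / (mu + la) * of_nat N) = 1"
        by (simp only: mconst_mult[symmetric] mconst_1)
      then have "mconst (1 / c) * (mconst (mu / (mu + la) * of_nat N) * x) = x" for x
        by (simp only: mult.assoc[symmetric] mult_1_left)
      moreover have "mu + la \<noteq> 0"
        using N r by (simp add: sum)
      ultimately show ?thesis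
        using False by (simp add: phi_powr_convolution phi_powr_weighted_convolution)
    qed
    finally show ?thesis .
  qed
  finally show "(Pmat r * Vmat r) $$ (a,i) = 1\<^sub>m (r - 1) $$ (a,i)"
    using a i by simp
qed (simp_all add: Pmat_def Vmat_def)

section \<open>Polynomial parts of the powers of w\<close>

definition vpol :: "nat \<Rightarrow> nat \<Rightarrow> rat mpol poly" where
  "vpol r i = (\<Sum>k\<le>r-1-i. monom (phi_coeff r (of_nat (r - 1 - i) / of_nat r) k) (r - 1 - i - k))"

lemma coeff_vpol:
  "coeff (vpol r i) t =
    (if t \<le> r - 1 - i then phi_coeff r (of_nat (r - 1 - i) / of_nat r) (r - 1 - i - t) else 0)"
proof -
  have "(\<Sum>k\<le>c. if c - k = t then p k else 0) = (if t \<le> c then p (c - t) else 0)"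
    for c and p :: "nat \<Rightarrow> rat mpol"
  proof -
    have "(\<Sum>k\<le>c. if c - k = t then p k else 0) =
        (\<Sum>k\<le>c. if k = c - t then (if t \<le> c then p (c - t) else 0) else 0)"
      by (rule sum.cong) auto
    then show ?thesis
      by simp
  qed
  then show ?thesis
    by (auto simp only: vpol_def coeff_sum coeff_monom)
qed

text \<open>Column \<open>i\<close> of \<open>Vmat r\<close> lists the coefficients of
  \<open>v_i' / (r-1-i)\<close> in the basis \<open>x^(r-2-l)\<close>, so this is column
  \<open>j\<close> of \<open>Vmat r * Pmat r = 1\<close>.\<close>

lemma monom_eq_sum_pderiv_vpol:
  assumes j: "j < r - 1"
  shows "monom 1 (r - 2 - j) =
    (\<Sum>i<r-1. smult (Pmat r $$ (i,j) * mconst (1 / of_nat (r - 1 - i))) (pderiv (vpol r i)))"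
proof (rule poly_eqI)
  fix t
  have VP: "Vmat r * Pmat r = 1\<^sub>m (r - 1)"
    by (rule mat_left_inverse_if_right_inverse[OF _ _ Pmat_Vmat]) (simp_all add: Pmat_def Vmat_def)
  show "coeff (monom 1 (r - 2 - j)) t = coeff (\<Sum>i<r-1.
      smult (Pmat r $$ (i,j) * mconst (1 / of_nat (r - 1 - i))) (pderiv (vpol r i))) t"
  proof (cases "t < r - 1")
    case False
    then have "coeff (pderiv (vpol r i)) t = 0" for i
      by (simp add: coeff_pderiv coeff_vpol)
    then show ?thesis
      using False j by (simp add: coeff_sum)
  next
    case True
    define l where "l = r - 2 - t"
    have l: "l < r - 1" "t = r - 2 - l"
      using True by (auto simp: l_def)
    have "mconst (1 / of_nat (r - 1 - i)) * coeff (pderiv (vpol r i)) t = Vmat r $$ (l,i)"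
      if i: "i < r - 1" for i
    proof (cases "i \<le> l")
      case False
      then show ?thesis
        using i l by (simp add: coeff_pderiv coeff_vpol Vmat_def)
    next
      case True
      have "r - 1 - i - Suc t = l - i" "Suc t = r - 1 - l"
        using l i True by auto
      moreover have "(mconst (1 / of_nat (r - 1 - i)) :: rat mpol) * of_nat (r - 1 - l) =
        mconst (of_nat (r - 1 - l) / of_nat (r - 1 - i))"
        by (simp only: mconst_of_nat[symmetric] mconst_mult[symmetric]) simp
      ultimately show ?thesis
        using i l True
        by (simp add: coeff_pderiv coeff_vpol Vmat_def mult.assoc[symmetric] del: of_nat_Suc)
    qed
    then have "(\<Sum>i<r-1. Pmat r $$ (i,j) * (mconst (1 / of_nat (r - 1 - i)) * coeff (pderiv (vpol r i)) t)) =
       (\<Sum>i<r-1. Vmat r $$ (l,i) * Pmat r $$ (i,j))"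
      by (intro sum.cong) (auto simp: mult.commute)
    also have "\<dots> = (Vmat r * Pmat r) $$ (l,j)"
      using l j by (simp add: Pmat_def Vmat_def scalar_prod_def lessThan_atLeast0)
    also have "\<dots> = coeff (monom 1 (r - 2 - j)) t"
      using l j by (auto simp: VP)
    finally show ?thesis
      by (simp add: coeff_sum mult.assoc)
  qed
qed

subsection \<open>Bezout matrices\<close>

text \<open>Row \<open>i\<close> of the Bezout matrix is \<open>bez_poly F G (Suc i)\<close>, as a polynomial in \<open>y\<close>.\<close>

definition bez_poly :: "'a::idom poly \<Rightarrow> 'a poly \<Rightarrow> nat \<Rightarrow> 'a poly" where
  "bez_poly F G i = poly_shift i F * G - poly_shift i G * F"

lemma poly_shift_eq_pCons: "poly_shift i F = pCons (coeff F i) (poly_shift (Suc i) F)"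
  by (auto simp: poly_eq_iff coeff_poly_shift coeff_pCons split: nat.splits)

text \<open>The virtual row before the first one vanishes: this is the divisibility of the numerator
  by \<open>x - y\<close>.\<close>

lemma bez_poly_0: "bez_poly F G 0 = 0"
  by (simp add: bez_poly_def mult.commute)

text \<open>Division by \<open>x - y\<close>, one power of \<open>x\<close> at a time: the
  coefficient of \<open>x^i\<close> in \<open>(x - y) * B\<close> is row \<open>i - 1\<close> minus
  \<open>y\<close> times row \<open>i\<close>, and \<open>bez_poly F G i\<close> is row
  \<open>i - 1\<close>.\<close>

lemma bez_poly_rec:
  "bez_poly F G i = smult (coeff F i) G - smult (coeff G i) F + pCons 0 (bez_poly F G (Suc i))"
  unfolding bez_poly_def
  by (subst (1 2) poly_shift_eq_pCons) simp

lemma bez_poly_eq_0: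
  assumes "i > max (degree F) (degree G)"
  shows "bez_poly F G i = 0"
proof -
  have "poly_shift i F = 0" "poly_shift i G = 0"
    using assms by (auto simp: poly_eq_iff coeff_poly_shift intro!: coeff_eq_0)
  then show ?thesis
    by (simp add: bez_poly_def)
qed

text \<open>The two products defining \<open>bez_poly\<close> may have larger degree, but their top
  parts cancel. After multiplication by \<open>y^(i+1)\<close> the shifts can be replaced by cutoffs
  of degree at most \<open>i\<close>, which gives the bound.\<close>

lemma coeff_bez_poly_eq_0:
  assumes "j \<ge> max (degree F) (degree G)"
  shows "coeff (bez_poly F G (Suc i)) j = 0"
proof -
  let ?k = "Suc i"
  have split: "monom 1 ?k * poly_shift ?k H = H - poly_cutoff ?k H" for H :: "'a poly"
    by (auto simp: poly_eq_iff coeff_monom_mult coeff_poly_shift coeff_poly_cutoff)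
  have deg: "degree (poly_cutoff ?k H) \<le> i" for H :: "'a poly"
    by (rule degree_le) (auto simp: coeff_poly_cutoff)
  have "monom 1 ?k * bez_poly F G ?k = poly_cutoff ?k G * F - poly_cutoff ?k F * G"
  proof -
    have "monom 1 ?k * bez_poly F G ?k = (monom 1 ?k * poly_shift ?k F) * G - (monom 1 ?k * poly_shift ?k G) * F"
      by (simp only: bez_poly_def right_diff_distrib mult.assoc)
    then show ?thesis
      by (simp only: split left_diff_distrib mult.commute[of G F]) simp
  qed
  moreover have "coeff (poly_cutoff ?k H * K) (j + ?k) = 0"
    if "degree K \<le> max (degree F) (degree G)" for H K :: "'a poly"
    using degree_mult_le[of "poly_cutoff ?k H" K] deg[of H] assms that by (intro coeff_eq_0) linarith
  ultimately have "coeff (monom 1 ?k * bez_poly F G ?k) (j + ?k) = 0"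
    by simp
  then show ?thesis
    by (simp add: coeff_monom_mult)
qed

lemma coeff_sum_monom_monom:
  "coeff (coeff (\<Sum>i<D. \<Sum>j<D. monom (monom (b i j) j) i) k) l = (if k < D \<and> l < D then b k l else 0)"
proof -
  have "coeff (coeff (monom (monom (b i j) j) i) k) l = (if i = k then if j = l then b i j else 0 else 0)" for i j
    by simp
  then have "coeff (coeff (\<Sum>i<D. \<Sum>j<D. monom (monom (b i j) j) i) k) l =
      (\<Sum>i<D. \<Sum>j<D. if i = k then if j = l then b i j else 0 else 0)"
    by (simp only: coeff_sum)
  also have "\<dots> = (\<Sum>i<D. if i = k then \<Sum>j<D. if j = l then b i j else 0 else 0)"
    by (intro sum.cong refl) simp
  finally show ?thesis
    by simp
qed

text \<open>Existence and uniqueness, which the definite description in \<open>Bez\<close> requires.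
  The rows \<open>bez_poly\<close> solve the identity by their recursion, and over a domain the
  factor \<open>x - y\<close> can be cancelled.\<close>

lemma bez_identity_iff:
  fixes F G :: "'a::idom poly"
  defines "D \<equiv> max (degree F) (degree G)"
  shows "bez_identity F G B \<longleftrightarrow> B = mat D D (\<lambda>(i,j). coeff (bez_poly F G (Suc i)) j)"
proof -
  let ?X = "[:0, 1:] - [:[:0, 1:]:] :: 'a poly poly"
  let ?N = "map_poly (\<lambda>c. [:c:]) F * [:G:] - [:F:] * map_poly (\<lambda>c. [:c:]) G"
  let ?S = "\<lambda>b. \<Sum>i<D. \<Sum>j<D. monom (monom (b i j) j) i :: 'a poly poly"
  define b0 where "b0 i j = coeff (bez_poly F G (Suc i)) j" for i j
  \<comment> \<open>Truncating both indices at \<open>D\<close> loses nothing, by the two vanishing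
    lemmas above.\<close>
  have S0: "coeff (?S b0) i = bez_poly F G (Suc i)" for i
  proof (rule poly_eqI)
    fix j
    show "coeff (coeff (?S b0) i) j = coeff (bez_poly F G (Suc i)) j"
    proof (cases "i < D \<and> j < D")
      case True
      then show ?thesis
        by (simp only: coeff_sum_monom_monom b0_def) simp
    next
      case False
      then have "max (degree F) (degree G) \<le> j \<or> max (degree F) (degree G) < Suc i"
        by (auto simp: D_def)
      then have "coeff (bez_poly F G (Suc i)) j = 0"
        using coeff_bez_poly_eq_0 bez_poly_eq_0 by (metis coeff_0)
      then show ?thesis
        using False by (simp only: coeff_sum_monom_monom) simp
    qed
  qed
  have N: "coeff ?N i = smult (coeff F i) G - smult (coeff G i) F" for i
  proof -
    have "coeff (p * [:H:]) i = coeff p i * H" for p and H :: "'a poly"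
      by simp
    moreover have "coeff (map_poly (\<lambda>c. [:c:]) H) i = [:coeff H i:]" for H :: "'a poly"
      by (simp add: coeff_map_poly)
    moreover have "[:F:] * p = p * [:F:]" for p
      by (rule mult.commute)
    ultimately show ?thesis
      by (simp only: coeff_diff mult_pCons_left pCons_0_0 mult_zero_left add_0_right)
  qed
  have "?N = ?X * ?S b0"
  proof (rule poly_eqI)
    fix i
    have X: "?X * p = pCons 0 p - smult [:0, 1:] p" for p
    proof -
      have "[:0, 1:] * p = pCons 0 p" "[:[:0, 1:]:] * p = smult [:0, 1:] p"
        by simp_all
      then show ?thesis
        by (simp only: left_diff_distrib)
    qed
    show "coeff ?N i = coeff (?X * ?S b0) i"
    proof -
      have "coeff (?X * ?S b0) i = bez_poly F G i - [:0, 1:] * bez_poly F G (Suc i)"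
        unfolding X coeff_diff coeff_smult S0 coeff_pCons
        by (cases i) (simp_all only: S0 bez_poly_0 nat.case)
      also have "\<dots> = smult (coeff F i) G - smult (coeff G i) F"
        by (subst bez_poly_rec) simp
      finally show ?thesis
        by (simp only: N)
    qed
  qed
  moreover have "?X \<noteq> 0"
    by simp
  ultimately have "?N = ?X * ?S b \<longleftrightarrow> ?S b0 = ?S b" for b
    by (simp only: mult_cancel_left) simp
  also have "?S b0 = ?S b \<longleftrightarrow> (\<forall>i<D. \<forall>j<D. b i j = b0 i j)" for b
    unfolding poly_eq_iff coeff_sum_monom_monom by auto
  finally have main: "?N = ?X * ?S b \<longleftrightarrow> (\<forall>i<D. \<forall>j<D. b i j = b0 i j)" for b .
  show ?thesis
    unfolding bez_identity_def Let_def D_def[symmetric] main b0_def by auto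
qed

lemma Bez_eq:
  fixes F G :: "'a::idom poly"
  defines "D \<equiv> max (degree F) (degree G)"
  shows "Bez F G = mat D D (\<lambda>(i,j). coeff (bez_poly F G (Suc i)) j)"
  unfolding Bez_def bez_identity_iff D_def by simp

section \<open>The pair of polynomials behind the matrix B\<close>

abbreviation Bez_F :: "nat \<Rightarrow> rat mpol poly" where
  "Bez_F r \<equiv> pderiv (fpol r)"

abbreviation Bez_G :: "nat \<Rightarrow> rat mpol poly" where
  "Bez_G r \<equiv> fpol r - smult (mconst (1 / of_nat r)) (monom 1 1 * pderiv (fpol r))"

lemma coeff_Bez_F: "coeff (Bez_F r) t = of_nat (Suc t) * coeff (fpol r) (Suc t)"
  by (simp add: coeff_pderiv)

lemma coeff_Bez_G:
  "coeff (Bez_G r) t = mconst (1 - of_nat t / of_nat r) * coeff (fpol r) t"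
proof -
  have "mconst (1 / of_nat r) * of_nat t = mconst (of_nat t / of_nat r :: rat)"
    by (simp only: mconst_of_nat[symmetric] mconst_mult[symmetric]) simp
  moreover have "coeff (monom 1 1 * pderiv (fpol r)) t = of_nat t * coeff (fpol r :: rat mpol poly) t"
    by (cases t) (simp_all add: coeff_monom_mult coeff_pderiv)
  ultimately show ?thesis
    by (simp add: mconst_diff mconst_1 left_diff_distrib mult.assoc[symmetric])
qed

text \<open>This fixes the size of the Bezout matrix. The factor \<open>1 - t/r\<close> removes the
  term \<open>t = r\<close> of \<open>Bez_G r\<close>, while \<open>Bez_F r\<close> has leading
  coefficient \<open>r\<close>, nonzero in characteristic 0.\<close>

lemma degree_Bez_FG:
  assumes "r \<ge> 2"
  shows "max (degree (Bez_F r)) (degree (Bez_G r)) = r - 1"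
proof (intro antisym max.boundedI)
  show "degree (Bez_F r) \<le> r - 1"
    by (rule degree_le) (use assms in \<open>auto simp: coeff_Bez_F coeff_fpol\<close>)
  show "degree (Bez_G r) \<le> r - 1"
  proof (rule degree_le, intro allI impI)
    fix i assume "r - 1 < i"
    then have "i = r \<or> i > r" by auto
    then show "coeff (Bez_G r) i = 0"
      using assms unfolding coeff_Bez_G by (auto simp: coeff_fpol mconst_0)
  qed
  have "Suc (r - 1) = r"
    using assms by simp
  then have "coeff (Bez_F r) (r - 1) = of_nat r"
    unfolding coeff_Bez_F by (simp add: coeff_fpol)
  then have "coeff (Bez_F r) (r - 1) \<noteq> 0"
    using assms by (simp add: coeff_Bez_F)
  then show "r - 1 \<le> max (degree (Bez_F r)) (degree (Bez_G r))"
    using le_degree by (metis max.coboundedI1)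
qed

lemma Bez_FG_eq:
  assumes "r \<ge> 2"
  shows "Bez (Bez_F r) (Bez_G r) =
    mat (r - 1) (r - 1) (\<lambda>(i,j). coeff (bez_poly (Bez_F r) (Bez_G r) (Suc i)) j)"
  unfolding Bez_eq degree_Bez_FG[OF assms] ..

text \<open>\<open>Jmat\<close> reverses the rows, so row \<open>b\<close> of \<open>Bmat r\<close>
  belongs to the power \<open>x^(r-2-b)\<close>.\<close>

lemma Bmat_index:
  assumes "r \<ge> 2" "b < r - 1" "k < r - 1"
  shows "Bmat r $$ (b,k) = coeff (bez_poly (Bez_F r) (Bez_G r) (r - 1 - b)) k"
proof -
  let ?Z = "\<lambda>i. coeff (bez_poly (Bez_F r) (Bez_G r) (Suc i)) k"
  have "Bmat r $$ (b,k) = (\<Sum>i<r-1. (if b + i + 1 = r - 1 then 1 else 0) * ?Z i)"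
    using assms unfolding Bmat_def Bez_FG_eq[OF assms(1)]
    by (simp add: Jmat_def scalar_prod_def lessThan_atLeast0)
  also have "\<dots> = (\<Sum>i<r-1. if i = r - 2 - b then ?Z i else 0)"
    by (rule sum.cong) (use assms in auto)
  also have "\<dots> = ?Z (r - 2 - b)"
    using assms by simp
  also have "Suc (r - 2 - b) = r - 1 - b"
    using assms by simp
  finally show ?thesis .
qed

text \<open>The linear functional \<open>y^k -> q k\<close> applied to a product: expanding one
  factor leaves the functional of \<open>y^s H\<close>. The bound on \<open>K\<close> lets the sum
  cover the whole product.\<close>

lemma sum_coeff_mult:
  fixes P H :: "'a::comm_ring_1 poly"
  assumes "degree P \<le> r" "degree H \<le> r" "2 * r \<le> K"
  shows "(\<Sum>k\<le>K. coeff (P * H) k * q k) =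
    (\<Sum>s\<le>r. coeff P s * (\<Sum>k\<le>r. coeff H k * q (k + s)))"
proof -
  have "P * H = (\<Sum>s\<le>r. monom (coeff P s) s) * (\<Sum>k\<le>r. monom (coeff H k) k)"
    using assms by (simp add: poly_as_sum_of_monoms')
  also have "\<dots> = (\<Sum>s\<le>r. \<Sum>k\<le>r. monom (coeff P s * coeff H k) (k + s))"
    by (simp add: sum_product mult_monom add.commute)
  finally have PH: "P * H = (\<Sum>s\<le>r. \<Sum>k\<le>r. monom (coeff P s * coeff H k) (k + s))" .
  have "(\<Sum>k\<le>K. coeff (P * H) k * q k) =
      (\<Sum>s\<le>r. \<Sum>k\<le>r. \<Sum>l\<le>K. (if k + s = l then coeff P s * coeff H k else 0) * q l)"
    unfolding PH coeff_sum coeff_monom sum_distrib_right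
    by (subst sum.swap[where A = "{..K}" and B = "{..r}"], rule sum.cong[OF refl],
        subst sum.swap[where A = "{..K}" and B = "{..r}"], rule refl)
  also have "\<dots> = (\<Sum>s\<le>r. \<Sum>k\<le>r. coeff P s * coeff H k * q (k + s))"
  proof (intro sum.cong refl)
    fix s k assume "s \<in> {..r}" "k \<in> {..r}"
    moreover have "(\<Sum>l\<le>K. (if k + s = l then x else 0) * q l) = (\<Sum>l\<le>K. if k + s = l then x * q l else 0)" for x
      by (rule sum.cong) auto
    ultimately show "(\<Sum>l\<le>K. (if k + s = l then coeff P s * coeff H k else 0) * q l) = coeff P s * coeff H k * q (k + s)"
      using assms by simp
  qed
  finally show ?thesis
    by (simp add: sum_distrib_left mult.assoc)
qed

lemma phi_powr_linear_convolution:
  assumes "a + b \<noteq> 0"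
  shows "(\<Sum>k\<le>N. mconst (u + v * of_nat k) * (phi_coeff r a k * phi_coeff r b (N - k))) =
    mconst (u + v * (a / (a + b) * of_nat N)) * phi_coeff r (a + b) N"
proof -
  have "(\<Sum>k\<le>N. mconst (u + v * of_nat k) * (phi_coeff r a k * phi_coeff r b (N - k))) =
    mconst u * (\<Sum>k\<le>N. phi_coeff r a k * phi_coeff r b (N - k)) +
    mconst v * (\<Sum>k\<le>N. of_nat k * (phi_coeff r a k * phi_coeff r b (N - k)))"
    by (simp only: mconst_add mconst_mult mconst_of_nat distrib_right sum.distrib sum_distrib_left mult.assoc)
  also have "\<dots> = mconst (u + v * (a / (a + b) * of_nat N)) * phi_coeff r (a + b) N"
    by (simp only: phi_powr_convolution phi_powr_weighted_convolution[OF assms] mconst_add mconst_mult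
        distrib_right mult.assoc)
  finally show ?thesis .
qed

section \<open>Residues of Bezout rows against powers of w\<close>

text \<open>
  \<open>q n\<close> is the coefficient of \<open>y\<^bsup>-n-1\<^esup>\<close> in \<open>w(y)\<^bsup>-i-1\<^esup>\<close>, so that the sums \<open>\<Sum>\<^sub>k h\<^sub>k * q (k + s)\<close> below are
  the residues of \<open>y\<^sup>s h(y) w(y)\<^bsup>-i-1\<^esup>\<close>; \<open>b k\<close> is the coefficient of \<open>x\<^bsup>c-k\<^esup>\<close> in \<open>w\<^sup>c\<close>.
\<close>

context
  fixes r i c :: nat and la :: rat and q b :: "nat \<Rightarrow> rat mpol"
  assumes i: "i < r - 1"
  defines "c \<equiv> r - 1 - i"
    and "la \<equiv> - of_nat (Suc i) / of_nat r"
    and "q \<equiv> \<lambda>n. if i \<le> n then phi_coeff r la (n - i) else 0"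
    and "b \<equiv> phi_coeff r (of_nat c / of_nat r)"
begin

lemma c_pos: "c > 0" and r_pos: "r > 0"
  using i by (auto simp: c_def)

lemma r_eq: "r = c + 1 + i"
  using i by (auto simp: c_def)

text \<open>Since \<open>f = w^r\<close>, the product \<open>f w^(-i-1)\<close> is
  \<open>w^c\<close>; this turns the residues below into coefficients of \<open>w^c\<close>.\<close>

lemma one_plus_la: "1 + la = of_nat c / of_nat r"
proof -
  have "(of_nat r :: rat) = of_nat c + 1 + of_nat i"
    by (subst r_eq) simp
  then show ?thesis
    using r_pos by (simp add: la_def field_simps)
qed

text \<open>\<open>f' w^(-i-1) = r w^(c-1) w'\<close> is \<open>r/c\<close> times the derivative of
  \<open>w^c\<close>; integrating by parts against \<open>y^s\<close> gives the factor
  \<open>-s\<close>.\<close>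

lemma sum_Bez_F: "(\<Sum>k\<le>r. coeff (Bez_F r) k * q (k + s)) = mconst (- (of_nat r * of_nat s / of_nat c)) * b (c + s)"
proof -
  let ?N = "c + s"
  let ?h = "\<lambda>k. mconst (of_nat r + (-1) * of_nat k) * (phi_coeff r 1 k * phi_coeff r la (?N - k))"
  let ?T = "{k. k \<le> ?N \<and> k < r}"
  have "(\<Sum>k\<le>r. coeff (Bez_F r) k * q (k + s)) =
    (\<Sum>k\<in>{k. k < r \<and> i \<le> k + s}. coeff (Bez_F r) k * q (k + s))"
    by (rule sum.mono_neutral_right) (auto simp: q_def coeff_Bez_F coeff_fpol)
  also have "\<dots> = sum ?h ?T"
  proof (rule sum.reindex_bij_witness[of _ "\<lambda>k. r - 1 - k" "\<lambda>k. r - 1 - k"])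
    fix k assume "k \<in> {k. k < r \<and> i \<le> k + s}"
    then have k: "k < r" "i \<le> k + s" by auto
    have "(of_nat r :: rat) + (-1) * of_nat (r - 1 - k) = of_nat (Suc k)"
      using k by (simp add: of_nat_diff)
    moreover have "?N - (r - 1 - k) = k + s - i"
      using k r_eq by simp
    moreover have "coeff (Bez_F r) k = of_nat (Suc k) * phi_coeff r 1 (r - 1 - k)"
      using k by (simp add: coeff_Bez_F coeff_fpol_eq)
    ultimately show "?h (r - 1 - k) = coeff (Bez_F r) k * q (k + s)"
      using k by (simp only: q_def mconst_of_nat mult.assoc if_True)
  qed (use r_eq in auto)
  \<comment> \<open>The term \<open>k = r\<close> is killed by its weight \<open>r - k\<close>, the
    later ones because \<open>phi\<close> has degree \<open>r\<close>.\<close>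
  also have "sum ?h ?T = sum ?h {..?N}"
  proof (rule sum.mono_neutral_left)
    show "\<forall>k\<in>{..?N} - ?T. ?h k = 0"
    proof
      fix k assume "k \<in> {..?N} - ?T"
      then have "k = r \<or> k > r" by auto
      then show "?h k = 0"
        by (auto simp: phi_powr_1 mconst_0)
    qed
  qed auto
  also have "\<dots> = mconst (of_nat r + (-1) * (1 / (1 + la) * of_nat ?N)) * phi_coeff r (1 + la) ?N"
    by (rule phi_powr_linear_convolution) (use c_pos r_pos in \<open>simp add: one_plus_la\<close>)
  also have "of_nat r + (-1) * (1 / (1 + la) * of_nat ?N) = - (of_nat r * of_nat s / of_nat c :: rat)"
    unfolding one_plus_la using c_pos r_pos by (simp add: field_simps)
  finally show ?thesis
    by (simp only: b_def one_plus_la)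
qed

text \<open>\<open>Bez_G r\<close> times \<open>w^(-i-1)\<close> is
  \<open>w^c - y (w^c)' / c\<close>, and the coefficient of \<open>y^(-s-1)\<close> there carries
  the factor \<open>1 + (s+1)/c\<close>.\<close>

lemma sum_Bez_G:
  "(\<Sum>k\<le>r. coeff (Bez_G r) k * q (k + s)) = mconst (of_nat (c + s + 1) / of_nat c) * b (c + s + 1)"
proof -
  let ?N = "c + s + 1"
  let ?h = "\<lambda>k. mconst (0 + 1 / of_nat r * of_nat k) * (phi_coeff r 1 k * phi_coeff r la (?N - k))"
  let ?T = "{k. k \<le> ?N \<and> k \<le> r}"
  have "(\<Sum>k\<le>r. coeff (Bez_G r) k * q (k + s)) =
    (\<Sum>k\<in>{k. k \<le> r \<and> i \<le> k + s}. coeff (Bez_G r) k * q (k + s))"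
    by (rule sum.mono_neutral_right) (auto simp: q_def)
  also have "\<dots> = sum ?h ?T"
  proof (rule sum.reindex_bij_witness[of _ "\<lambda>k. r - k" "\<lambda>k. r - k"])
    fix k assume "k \<in> {k. k \<le> r \<and> i \<le> k + s}"
    then have k: "k \<le> r" "i \<le> k + s" by auto
    have "(0 + 1 / of_nat r * of_nat (r - k) :: rat) = 1 - of_nat k / of_nat r"
      using k r_pos by (simp add: of_nat_diff field_simps)
    moreover have "?N - (r - k) = k + s - i"
      using k r_eq by simp
    moreover have "coeff (Bez_G r) k = mconst (1 - of_nat k / of_nat r) * phi_coeff r 1 (r - k)"
      using k by (simp only: coeff_Bez_G coeff_fpol_eq)
    ultimately show "?h (r - k) = coeff (Bez_G r) k * q (k + s)"
      using k by (simp only: q_def mult.assoc if_True)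
  qed (use r_eq in auto)
  also have "sum ?h ?T = sum ?h {..?N}"
    by (rule sum.mono_neutral_left) (auto simp: phi_powr_1)
  also have "\<dots> = mconst (0 + 1 / of_nat r * (1 / (1 + la) * of_nat ?N)) * phi_coeff r (1 + la) ?N"
    by (rule phi_powr_linear_convolution) (use c_pos r_pos in \<open>simp add: one_plus_la\<close>)
  also have "0 + 1 / of_nat r * (1 / (1 + la) * of_nat ?N) = (of_nat (c + s + 1) / of_nat c :: rat)"
    unfolding one_plus_la using c_pos r_pos by (simp add: field_simps)
  finally show ?thesis
    by (simp only: b_def one_plus_la)
qed

text \<open>The shifted factors of \<open>bez_poly\<close> are expanded in powers of
  \<open>y\<close>; the unshifted ones are evaluated by the two residue formulas.\<close>

lemma sum_bez_poly:
  assumes K: "2 * r \<le> K"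
  shows "(\<Sum>k\<le>K. coeff (bez_poly (Bez_F r) (Bez_G r) (Suc a)) k * q k) =
    (\<Sum>s<r. mconst (of_nat (a + 2 + s) + of_nat r / of_nat c * of_nat (s + 1)) *
       (coeff (fpol r) (a + 2 + s) * b (c + s + 1)))"
proof -
  let ?f = "coeff (fpol r)"
  have deg: "degree (Bez_F r) \<le> r" "degree (Bez_G r) \<le> r"
  proof -
    show "degree (Bez_F r) \<le> r"
      by (rule degree_le) (auto simp: coeff_Bez_F coeff_fpol)
    show "degree (Bez_G r) \<le> r"
      by (rule degree_le) (auto simp only: coeff_Bez_G coeff_fpol, auto)
  qed
  have deg': "degree (poly_shift n p) \<le> r" if "degree p \<le> r" for n and p :: "rat mpol poly"
    by (rule degree_le) (use that in \<open>auto simp: coeff_poly_shift intro!: coeff_eq_0\<close>)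
  let ?u = "\<lambda>s. mconst (of_nat (a + 2 + s) * of_nat (c + s + 1) / of_nat c) * (?f (a + 2 + s) * b (c + s + 1))"
  let ?w = "\<lambda>s. mconst ((of_nat r - of_nat (a + 1 + s)) * of_nat s / of_nat c) * (?f (a + 1 + s) * b (c + s))"
  have diff: "(\<Sum>k\<le>K. coeff (p - p') k * q k) =
      (\<Sum>k\<le>K. coeff p k * q k) - (\<Sum>k\<le>K. coeff p' k * q k)" for p p'
    by (simp only: coeff_diff left_diff_distrib sum_subtractf)
  have mult4: "(m * f) * (n * x) = (m * n) * (f * x)" for m f n x :: "rat mpol"
    by (simp only: mult_ac)
  have F: "coeff (poly_shift (Suc a) (Bez_F r)) s * (mconst (of_nat (c + s + 1) / of_nat c) * b (c + s + 1)) = ?u s" for s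
  proof -
    have "coeff (poly_shift (Suc a) (Bez_F r)) s = mconst (of_nat (a + 2 + s)) * ?f (a + 2 + s)"
    proof -
      have "Suc (s + Suc a) = a + 2 + s"
        by simp
      then show ?thesis
        by (simp only: coeff_poly_shift coeff_Bez_F mconst_of_nat)
    qed
    then show ?thesis
      by (simp only: mult4[of _ "?f (a + 2 + s)"])
         (simp only: mconst_mult[symmetric] times_divide_eq_right)
  qed
  have G: "coeff (poly_shift (Suc a) (Bez_G r)) s * (mconst (- (of_nat r * of_nat s / of_nat c)) * b (c + s)) = - ?w s" for s
  proof -
    have "coeff (poly_shift (Suc a) (Bez_G r)) s = mconst (1 - of_nat (a + 1 + s) / of_nat r) * ?f (a + 1 + s)"
      by (simp only: coeff_poly_shift coeff_Bez_G add_ac Suc_eq_plus1)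
    moreover have "(1 - of_nat (a + 1 + s) / of_nat r) * - (of_nat r * of_nat s / of_nat c) =
       - ((of_nat r - of_nat (a + 1 + s)) * of_nat s / of_nat c :: rat)"
      using r_pos c_pos by (simp add: field_simps)
    ultimately show ?thesis
      by (simp only: mult4[of _ "?f (a + 1 + s)"] mconst_mult[symmetric])
         (simp only: mconst_uminus minus_mult_left)
  qed
  have "(\<Sum>k\<le>K. coeff (bez_poly (Bez_F r) (Bez_G r) (Suc a)) k * q k) =
    (\<Sum>s\<le>r. ?u s) - (\<Sum>s\<le>r. - ?w s)"
    unfolding bez_poly_def diff
      sum_coeff_mult[OF deg'[OF deg(1)] deg(2) K] sum_coeff_mult[OF deg'[OF deg(2)] deg(1) K]
      sum_Bez_F sum_Bez_G F G ..
  also have "(\<Sum>s\<le>r. ?u s) = (\<Sum>s<r. ?u s)"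
    by (rule sum.mono_neutral_right) (auto simp: coeff_fpol)
  \<comment> \<open>The summand \<open>?w 0\<close> contains the factor \<open>s = 0\<close>.
    Shifting the index by one brings both sums to the same products
    \<open>f_(a+2+s) b(c+s+1)\<close>.\<close>
  also have "(\<Sum>s\<le>r. - ?w s) = - (\<Sum>s<r. ?w (Suc s))"
    by (simp add: sum.atMost_shift sum_negf mconst_0)
  also have "(\<Sum>s<r. ?u s) - - (\<Sum>s<r. ?w (Suc s)) = (\<Sum>s<r. ?u s + ?w (Suc s))"
    by (simp add: sum.distrib)
  also have "\<dots> = (\<Sum>s<r. mconst (of_nat (a + 2 + s) + of_nat r / of_nat c * of_nat (s + 1)) *
       (?f (a + 2 + s) * b (c + s + 1)))"
  proof (rule sum.cong)
    fix s
    have e: "a + 1 + Suc s = a + 2 + s" "c + Suc s = c + s + 1"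
      by auto
    have "of_nat (a + 2 + s) * of_nat (c + s + 1) / of_nat c +
        (of_nat r - of_nat (a + 2 + s)) * of_nat (Suc s) / of_nat c =
        (of_nat (a + 2 + s) + of_nat r / of_nat c * of_nat (s + 1) :: rat)"
      using c_pos by (simp add: field_simps)
    then show "?u s + ?w (Suc s) = mconst (of_nat (a + 2 + s) + of_nat r / of_nat c * of_nat (s + 1)) *
       (?f (a + 2 + s) * b (c + s + 1))"
      unfolding e by (simp only: distrib_right[symmetric] mconst_add[symmetric])
  qed simp
  finally show ?thesis .
qed

lemma coeff_vpol_b: "coeff (vpol r i) t = (if t \<le> c then b (c - t) else 0)"
  by (simp only: coeff_vpol c_def b_def)

text \<open>Multiplying by \<open>x\<close> turns \<open>d/dx\<close> into the Euler operator, which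
  weights each coefficient by its exponent; hence the index \<open>a + 1\<close>.\<close>

lemma coeff_reduction_target:
  "coeff (smult (mconst (of_nat r / of_nat c)) (pderiv (vpol r i) * fpol r) - vpol r i * pderiv (fpol r)) a =
    (\<Sum>t\<le>a+1. mconst (of_nat r / of_nat c * of_nat t - of_nat (a + 1 - t)) *
       (coeff (vpol r i) t * coeff (fpol r) (a + 1 - t)))"
proof -
  have x: "coeff p a = coeff (monom 1 1 * p) (a + 1)" for p :: "rat mpol poly"
    by (simp add: coeff_monom_mult)
  have x': "coeff (monom 1 1 * pderiv p) t = of_nat t * coeff p t" for p :: "rat mpol poly" and t
    by (cases t) (simp_all add: coeff_monom_mult coeff_pderiv)
  have "coeff (pderiv (vpol r i) * fpol r) a =
      (\<Sum>t\<le>a+1. of_nat t * (coeff (vpol r i) t * coeff (fpol r) (a + 1 - t)))"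
    by (subst x, subst mult.assoc[symmetric], subst coeff_mult) (simp only: x' mult.assoc)
  moreover have "coeff (vpol r i * pderiv (fpol r)) a =
      (\<Sum>t\<le>a+1. of_nat (a + 1 - t) * (coeff (vpol r i) t * coeff (fpol r) (a + 1 - t)))"
    by (subst x, subst mult.left_commute, subst coeff_mult) (simp only: x' mult.left_commute)
  ultimately show ?thesis
    by (simp only: coeff_diff coeff_smult mconst_diff mconst_mult mconst_of_nat left_diff_distrib
        sum_subtractf sum_distrib_left mult.assoc)
qed

text \<open>
  The full series \<open>W = w\<^sup>c\<close> satisfies \<open>W f' - (r/c) W' f = 0\<close>. The residue sum is the contribution of the
  negative part of \<open>W\<close> to the left-hand side, hence minus that of the polynomial part.
\<close>

lemma sum_bez_poly_eq_coeff:
  assumes K: "2 * r \<le> K"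
  shows "(\<Sum>k\<le>K. coeff (bez_poly (Bez_F r) (Bez_G r) (Suc a)) k * q k) =
    coeff (smult (mconst (of_nat r / of_nat c)) (pderiv (vpol r i) * fpol r) - vpol r i * pderiv (fpol r)) a"
proof (cases "a + 1 \<le> r + c")
  \<comment> \<open>Beyond degree \<open>r + c\<close> both sides vanish; excluding this range keeps
    the subtraction in \<open>N\<close> exact.\<close>
  case False
  then have "(\<Sum>t\<le>a+1. mconst (of_nat r / of_nat c * of_nat t - of_nat (a + 1 - t)) *
       (coeff (vpol r i) t * coeff (fpol r) (a + 1 - t))) = 0"
    by (intro sum.neutral) (auto simp: coeff_vpol_b coeff_fpol)
  moreover have "(\<Sum>s<r. mconst (of_nat (a + 2 + s) + of_nat r / of_nat c * of_nat (s + 1)) *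
       (coeff (fpol r) (a + 2 + s) * b (c + s + 1))) = 0"
    using False by (intro sum.neutral) (auto simp: coeff_fpol)
  ultimately show ?thesis
    by (simp only: sum_bez_poly[OF K] coeff_reduction_target)
next
  case True
  define N where "N = r + c - (a + 1)"
  have N: "N + (a + 1) = r + c"
    using True by (simp add: N_def)
  then have Nr: "of_nat N + (of_nat a + 1) = (of_nat r + of_nat c :: rat)"
    by (metis of_nat_add of_nat_1)
  \<comment> \<open>\<open>h k\<close> is the contribution of the term \<open>x^(c-k)\<close> of
    \<open>W = w^c\<close> to the coefficient of \<open>x^a\<close> in
    \<open>(r/c) W' f - W f'\<close>; its weight is \<open>(r/c)(c-k) - (r-N+k)\<close>. The terms
    sum to zero.\<close>
  define h where "h k = mconst (of_nat N + - (1 + of_nat r / of_nat c) * of_nat k) * (b k * phi_coeff r 1 (N - k))" for k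
  have "sum h {..N} = mconst (of_nat N + - (1 + of_nat r / of_nat c) *
      (of_nat c / of_nat r / (of_nat c / of_nat r + 1) * of_nat N)) * phi_coeff r (of_nat c / of_nat r + 1) N"
    unfolding h_def b_def
  proof (rule phi_powr_linear_convolution)
    have "(of_nat c / of_nat r + 1 :: rat) > 0"
      by (rule add_nonneg_pos) simp_all
    then show "(of_nat c / of_nat r + 1 :: rat) \<noteq> 0"
      by linarith
  qed
  also have "of_nat N + - (1 + of_nat r / of_nat c) *
      (of_nat c / of_nat r / (of_nat c / of_nat r + 1) * of_nat N) = (0 :: rat)"
  proof -
    have "(1 + of_nat r / of_nat c) * (of_nat c / of_nat r / (of_nat c / of_nat r + 1)) = (1 :: rat)"
    proof -
      have "(of_nat r + of_nat c :: rat) > 0"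
        using r_pos by (simp add: add_pos_nonneg)
      then show ?thesis
        using c_pos r_pos by (simp add: divide_simps add.commute)
    qed
    then have "(1 + of_nat r / of_nat c) * (of_nat c / of_nat r / (of_nat c / of_nat r + 1) * of_nat N) = (of_nat N :: rat)"
      by (simp only: mult.assoc[symmetric] mult_1_left)
    then show ?thesis
      by (simp only: mult_minus_left right_minus)
  qed
  finally have zero: "sum h {..N} = 0"
    by (simp add: mconst_0)
  have "(\<Sum>t\<le>a+1. mconst (of_nat r / of_nat c * of_nat t - of_nat (a + 1 - t)) *
       (coeff (vpol r i) t * coeff (fpol r) (a + 1 - t))) =
     (\<Sum>t\<in>{t. t \<le> a + 1 \<and> t \<le> c \<and> a + 1 - t \<le> r}. mconst (of_nat r / of_nat c * of_nat t - of_nat (a + 1 - t)) *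
       (coeff (vpol r i) t * coeff (fpol r) (a + 1 - t)))"
    by (rule sum.mono_neutral_right) (auto simp: coeff_vpol_b coeff_fpol)
  also have "\<dots> = sum h {k. k \<le> N \<and> k \<le> c \<and> c \<le> a + 1 + k}"
  proof (rule sum.reindex_bij_witness[of _ "\<lambda>k. c - k" "\<lambda>t. c - t"])
    fix t assume "t \<in> {t. t \<le> a + 1 \<and> t \<le> c \<and> a + 1 - t \<le> r}"
    then have t: "t \<le> a + 1" "t \<le> c" "a + 1 - t \<le> r" by auto
    have "r - (a + 1 - t) = N - (c - t)"
      using t N by auto
    moreover have "of_nat N + - (1 + of_nat r / of_nat c) * of_nat (c - t) =
      (of_nat r / of_nat c * of_nat t - of_nat (a + 1 - t) :: rat)"
    proof -
      have e: "(of_nat (a + 1 - t) :: rat) = of_nat a + 1 - of_nat t" "(of_nat (c - t) :: rat) = of_nat c - of_nat t"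
        using t by (simp_all add: of_nat_diff)
      have e': "(of_nat N :: rat) = of_nat r + of_nat c - (of_nat a + 1)"
        using Nr by simp
      show ?thesis
        unfolding e e' using c_pos by (simp add: field_simps)
    qed
    ultimately show "h (c - t) = mconst (of_nat r / of_nat c * of_nat t - of_nat (a + 1 - t)) *
       (coeff (vpol r i) t * coeff (fpol r) (a + 1 - t))"
      using t by (simp only: h_def coeff_vpol_b coeff_fpol_eq if_True)
  qed (use N in auto)
  \<comment> \<open>Where the exponent of \<open>f\<close> would be negative, \<open>N - k\<close>
    exceeds \<open>r\<close> and \<open>phi\<close> has no coefficient.\<close>
  also have "\<dots> = sum h {k. k \<le> N \<and> k \<le> c}"
  proof (rule sum.mono_neutral_left)
    show "\<forall>k\<in>{k. k \<le> N \<and> k \<le> c} - {k. k \<le> N \<and> k \<le> c \<and> c \<le> a + 1 + k}. h k = 0"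
    proof
      fix k assume "k \<in> {k. k \<le> N \<and> k \<le> c} - {k. k \<le> N \<and> k \<le> c \<and> c \<le> a + 1 + k}"
      then have "N - k > r"
        using N by auto
      then show "h k = 0"
        by (simp add: h_def phi_powr_1)
    qed
  qed auto
  finally have target: "(\<Sum>t\<le>a+1. mconst (of_nat r / of_nat c * of_nat t - of_nat (a + 1 - t)) *
       (coeff (vpol r i) t * coeff (fpol r) (a + 1 - t))) = sum h {k. k \<le> N \<and> k \<le> c}" .
  have "(\<Sum>s<r. mconst (of_nat (a + 2 + s) + of_nat r / of_nat c * of_nat (s + 1)) *
       (coeff (fpol r) (a + 2 + s) * b (c + s + 1))) =
     (\<Sum>s\<in>{s. a + 2 + s \<le> r}. mconst (of_nat (a + 2 + s) + of_nat r / of_nat c * of_nat (s + 1)) *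
       (coeff (fpol r) (a + 2 + s) * b (c + s + 1)))"
    by (rule sum.mono_neutral_right) (auto simp: coeff_fpol)
  \<comment> \<open>The residue sum runs over the terms of \<open>W\<close> with negative exponent
    \<open>c - k = -s-1\<close>.\<close>
  also have "\<dots> = (\<Sum>k\<in>{k. k \<le> N \<and> c < k}. - h k)"
  proof (rule sum.reindex_bij_witness[of _ "\<lambda>k. k - c - 1" "\<lambda>s. c + s + 1"])
    fix s assume "s \<in> {s. a + 2 + s \<le> r}"
    then have s: "a + 2 + s \<le> r" by auto
    have "r - (a + 2 + s) = N - (c + s + 1)"
      using s N by auto
    moreover have "- (of_nat N + - (1 + of_nat r / of_nat c) * of_nat (c + s + 1)) =
      (of_nat (a + 2 + s) + of_nat r / of_nat c * of_nat (s + 1) :: rat)"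
    proof -
      have e: "(of_nat N :: rat) = of_nat r + of_nat c - (of_nat a + 1)"
        using Nr by simp
      show ?thesis
        unfolding e using c_pos by (simp add: field_simps)
    qed
    ultimately show "- h (c + s + 1) = mconst (of_nat (a + 2 + s) + of_nat r / of_nat c * of_nat (s + 1)) *
       (coeff (fpol r) (a + 2 + s) * b (c + s + 1))"
      using s unfolding h_def minus_mult_left mconst_uminus[symmetric] by (simp only: coeff_fpol_eq mult.commute)
  qed (use N in auto)
  also have "\<dots> = sum h {k. k \<le> N \<and> k \<le> c}"
  proof -
    have "sum h {..N} = sum h {k. k \<le> N \<and> k \<le> c} + sum h {k. k \<le> N \<and> c < k}"
      by (subst sum.union_disjoint[symmetric]) (auto intro!: sum.cong)
    then have "sum h {k. k \<le> N \<and> c < k} = - sum h {k. k \<le> N \<and> k \<le> c}"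
      unfolding zero by (metis add_eq_0_iff)
    then show ?thesis
      by (simp add: sum_negf)
  qed
  finally show ?thesis
    by (simp only: sum_bez_poly[OF K] coeff_reduction_target target)
qed

end

subsection \<open>The reduction identity over the rationals\<close>

lemma Qmat_index:
  assumes "k < r - 1" "i < r - 1"
  shows "Qmat r $$ (k,i) = (if i \<le> k then phi_coeff r (- of_nat (Suc i) / of_nat r) (k - i) else 0)"
  using assms by (simp add: Qmat_def beta_diff)

lemma Bmat_carrier: "r \<ge> 2 \<Longrightarrow> Bmat r \<in> carrier_mat (r - 1) (r - 1)"
  unfolding Bmat_def by (simp only: Bez_FG_eq) (auto simp: Jmat_def intro!: mult_carrier_mat)

lemma Qmat_carrier: "Qmat r \<in> carrier_mat (r - 1) (r - 1)"
  and Zmat_carrier: "Zmat r n \<in> carrier_mat (r - 1) (r - 1)"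
  and Pmat_carrier: "Pmat r \<in> carrier_mat (r - 1) (r - 1)"
  by (simp_all add: Qmat_def Zmat_def Pmat_def)

lemma sum_mat_index:
  assumes "A \<in> carrier_mat n m" "B \<in> carrier_mat m l" "i < n" "j < l"
  shows "(A * B) $$ (i,j) = (\<Sum>k<m. A $$ (i,k) * B $$ (k,j))"
  using assms by (simp add: scalar_prod_def lessThan_atLeast0)

lemma coeff_sum_monom_rev:
  "coeff (\<Sum>b<m. monom (x b) (m - 1 - b)) a = (if a < m then x (m - 1 - a) else 0)"
proof (cases "a < m")
  case True
  have "coeff (\<Sum>b<m. monom (x b) (m - 1 - b)) a = (\<Sum>b<m. if b = m - 1 - a then x b else 0)"
    unfolding coeff_sum coeff_monom by (rule sum.cong) (use True in auto)
  then show ?thesis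
    using True by simp
qed (auto simp: coeff_sum intro!: sum.neutral)

text \<open>Column \<open>i\<close> of \<open>Qmat r\<close> holds the first coefficients of
  \<open>w^(-i-1)\<close>, so each entry of the product is the residue sum of one Bezout row; the
  row reversal matches the exponent \<open>r-2-b\<close>.\<close>

lemma Bmat_Qmat_poly:
  assumes r: "r \<ge> 2" and i: "i < r - 1"
  shows "(\<Sum>b<r-1. monom ((Bmat r * Qmat r) $$ (b,i)) (r - 1 - 1 - b)) =
    smult (mconst (of_nat r / of_nat (r - 1 - i))) (pderiv (vpol r i) * fpol r) - vpol r i * pderiv (fpol r)"
proof (rule poly_eqI)
  fix a
  let ?q = "\<lambda>k. if i \<le> k then phi_coeff r (- of_nat (Suc i) / of_nat r) (k - i) else 0"
  let ?p = "bez_poly (Bez_F r) (Bez_G r) (Suc a)"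
  have "coeff (smult (mconst (of_nat r / of_nat (r - 1 - i))) (pderiv (vpol r i) * fpol r) - vpol r i * pderiv (fpol r)) a
      = (\<Sum>k\<le>2*r. coeff ?p k * ?q k)"
    by (rule sum_bez_poly_eq_coeff[OF i order_refl, symmetric])
  \<comment> \<open>Bezout rows have degree below \<open>r - 1\<close>, so only the coefficients
    stored in \<open>Qmat r\<close> are met.\<close>
  also have "\<dots> = (\<Sum>k<r-1. coeff ?p k * ?q k)"
  proof (rule sum.mono_neutral_right)
    show "\<forall>k\<in>{..2*r} - {..<r-1}. coeff ?p k * ?q k = 0"
    proof
      fix k assume "k \<in> {..2*r} - {..<r-1}"
      then have "coeff ?p k = 0"
        by (intro coeff_bez_poly_eq_0) (simp only: degree_Bez_FG[OF r], simp)
      then show "coeff ?p k * ?q k = 0"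
        by (simp only: mult_zero_left)
    qed
  qed auto
  also have "\<dots> = coeff (\<Sum>b<r-1. monom ((Bmat r * Qmat r) $$ (b,i)) (r - 1 - 1 - b)) a"
  proof (cases "a < r - 1")
    case True
    then have a: "r - 1 - 1 - a < r - 1" "r - 1 - (r - 1 - 1 - a) = Suc a"
      by auto
    have "(Bmat r * Qmat r) $$ (r - 1 - 1 - a, i) =
        (\<Sum>k<r-1. Bmat r $$ (r - 1 - 1 - a, k) * Qmat r $$ (k,i))"
      by (rule sum_mat_index[OF Bmat_carrier[OF r] Qmat_carrier a(1) i])
    also have "\<dots> = (\<Sum>k<r-1. coeff ?p k * ?q k)"
      by (rule sum.cong) (simp_all only: lessThan_iff Bmat_index[OF r a(1)] a(2) Qmat_index[OF _ i])
    finally show ?thesis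
      using True by (simp only: coeff_sum_monom_rev if_True)
  next
    case False
    then have "?p = 0"
      by (intro bez_poly_eq_0, subst degree_Bez_FG[OF r]) simp
    then show ?thesis
      using False by (simp only: coeff_sum_monom_rev) simp
  qed
  finally show "coeff (\<Sum>b<r-1. monom ((Bmat r * Qmat r) $$ (b,i)) (r - 1 - 1 - b)) a =
    coeff (smult (mconst (of_nat r / of_nat (r - 1 - i))) (pderiv (vpol r i) * fpol r) - vpol r i * pderiv (fpol r)) a"
    by (rule sym)
qed

text \<open>The polynomial \<open>v\<close> of the reduction. With \<open>c = r-1-i\<close>, the
  derivative of \<open>w^(c-rn)\<close> is \<open>(c-rn) w^(c-rn-1) w'\<close>, whence the
  constants.\<close>

definition primitive_pol :: "nat \<Rightarrow> int \<Rightarrow> nat \<Rightarrow> rat mpol poly" where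
  "primitive_pol r n j =
    (\<Sum>i<r-1. smult (Pmat r $$ (i,j) * mconst (1 / (of_nat (r - 1 - i) - of_nat r * of_int n))) (vpol r i))"

definition remainder_pol :: "nat \<Rightarrow> int \<Rightarrow> nat \<Rightarrow> rat mpol poly" where
  "remainder_pol r n j =
    (\<Sum>b<r-1. monom ((Bmat r * Qmat r * Zmat r n * Pmat r) $$ (b,j)) (r - 1 - 1 - b))"

lemma remainder_pol_eq:
  assumes r: "r \<ge> 2" and j: "j < r - 1"
  shows "remainder_pol r n j = (\<Sum>i<r-1. smult (Pmat r $$ (i,j) *
      mconst (of_int n / (of_nat r * of_int n - of_nat (r - 1 - i))))
      (\<Sum>b<r-1. monom ((Bmat r * Qmat r) $$ (b,i)) (r - 1 - 1 - b)))"
proof -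
  let ?z = "\<lambda>i. mconst (of_int n / (of_nat r * of_int n - of_nat (r - 1 - i))) :: rat mpol"
  have BQ: "Bmat r * Qmat r \<in> carrier_mat (r - 1) (r - 1)"
    using Bmat_carrier[OF r] Qmat_carrier by (rule mult_carrier_mat)
  have BQZ: "Bmat r * Qmat r * Zmat r n \<in> carrier_mat (r - 1) (r - 1)"
    using BQ Zmat_carrier by (rule mult_carrier_mat)
  have "(Bmat r * Qmat r * Zmat r n) $$ (b,i) = (Bmat r * Qmat r) $$ (b,i) * ?z i"
    if "b < r - 1" "i < r - 1" for b i
  proof -
    have "(Bmat r * Qmat r * Zmat r n) $$ (b,i) = (\<Sum>k<r-1. (Bmat r * Qmat r) $$ (b,k) * Zmat r n $$ (k,i))"
      by (rule sum_mat_index[OF BQ Zmat_carrier that])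
    also have "\<dots> = (\<Sum>k<r-1. if k = i then (Bmat r * Qmat r) $$ (b,k) * ?z k else 0)"
      by (rule sum.cong) (use that in \<open>auto simp: Zmat_def of_nat_diff\<close>)
    finally show ?thesis
      using that by simp
  qed
  then have "(Bmat r * Qmat r * Zmat r n * Pmat r) $$ (b,j) =
      (\<Sum>i<r-1. (Pmat r $$ (i,j) * ?z i) * (Bmat r * Qmat r) $$ (b,i))" if "b < r - 1" for b
    unfolding sum_mat_index[OF BQZ Pmat_carrier that j]
    using that by (intro sum.cong) (auto simp: mult_ac)
  then have "remainder_pol r n j = (\<Sum>b<r-1. \<Sum>i<r-1. smult (Pmat r $$ (i,j) * ?z i)
      (monom ((Bmat r * Qmat r) $$ (b,i)) (r - 1 - 1 - b)))"
    unfolding remainder_pol_def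
    by (intro sum.cong) (simp_all add: smult_monom monom_sum)
  then show ?thesis
    by (subst (asm) sum.swap) (simp only: smult_sum2)
qed

text \<open>It suffices to check one \<open>v_i\<close>, with \<open>c = r-1-i\<close>. The terms
  \<open>v_i f'\<close> cancel, and the terms \<open>v_i' f\<close> match because
  \<open>1/c = 1/(c-rn) + n/(rn-c) * r/c\<close>.\<close>

lemma reduction_identity:
  assumes r: "r \<ge> 2" and j: "j < r - 1"
    and n: "\<And>i. i < r - 1 \<Longrightarrow> (of_nat (r - 1 - i) - of_nat r * of_int n :: rat) \<noteq> 0"
  shows "monom 1 (r - 2 - j) * fpol r =
    pderiv (primitive_pol r n j) * fpol r
      - smult (of_int n) (primitive_pol r n j * pderiv (fpol r)) + remainder_pol r n j"
proof -
  let ?f = "fpol r :: rat mpol poly"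
  let ?c = "\<lambda>i. of_nat (r - 1 - i) :: rat"
  let ?b = "\<lambda>i. mconst (1 / (?c i - of_nat r * of_int n)) :: rat mpol"
  let ?v = "\<lambda>i. vpol r i"
  have term_eq: "smult (Pmat r $$ (i,j) * mconst (1 / ?c i)) (pderiv (?v i)) * ?f =
      smult (Pmat r $$ (i,j) * ?b i) (pderiv (?v i)) * ?f
      - smult (of_int n) (smult (Pmat r $$ (i,j) * ?b i) (?v i) * pderiv ?f)
      + smult (Pmat r $$ (i,j) * mconst (of_int n / (of_nat r * of_int n - ?c i)))
          (smult (mconst (of_nat r / ?c i)) (pderiv (?v i) * ?f) - ?v i * pderiv ?f)"
    if i: "i < r - 1" for i
  proof -
    let ?z = "of_int n / (of_nat r * of_int n - ?c i)"
    have c: "?c i \<noteq> 0" using i by simp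
    have z: "N / (R * N - C) = - (N * (1 / (C - R * N)))" for N R C :: rat
      using minus_divide_right[of N "C - R * N"] by simp
    have "1 / C = 1 / (C - R * N) + N / (R * N - C) * (R / C)"
      if "C \<noteq> 0" "C - R * N \<noteq> 0" for C R N :: rat
      unfolding z using that by (simp add: divide_simps)
    from this[OF c n[OF i]] have 1: "mconst (1 / ?c i) = ?b i + mconst ?z * mconst (of_nat r / ?c i)"
      by (simp only: mconst_add mconst_mult)
    have 2: "mconst ?z = - (of_int n * ?b i)"
      by (simp only: z mconst_uminus mconst_mult mconst_of_int)
    have "smult (p * (b + z * w)) X * ?f = smult (p * b) X * ?f - smult k (smult (p * b) V * Y)
        + smult (p * z) (smult w (X * ?f) - V * Y)" if "z = - (k * b)" for p b z w k X V Y
      unfolding that by (simp add: smult_diff_right smult_diff_left right_diff_distrib mult_ac)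
    from this[OF 2] show ?thesis
      unfolding 1 .
  qed
  have "monom 1 (r - 2 - j) * ?f =
      (\<Sum>i<r-1. smult (Pmat r $$ (i,j) * mconst (1 / ?c i)) (pderiv (?v i)) * ?f)"
    unfolding monom_eq_sum_pderiv_vpol[OF j] sum_distrib_right ..
  also have "\<dots> = (\<Sum>i<r-1. smult (Pmat r $$ (i,j) * ?b i) (pderiv (?v i)) * ?f
      - smult (of_int n) (smult (Pmat r $$ (i,j) * ?b i) (?v i) * pderiv ?f)
      + smult (Pmat r $$ (i,j) * mconst (of_int n / (of_nat r * of_int n - ?c i)))
          (smult (mconst (of_nat r / ?c i)) (pderiv (?v i) * ?f) - ?v i * pderiv ?f))"
    by (rule sum.cong[OF refl], rule term_eq) simp
  also have "\<dots> = (\<Sum>i<r-1. smult (Pmat r $$ (i,j) * ?b i) (pderiv (?v i))) * ?f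
      - smult (of_int n) ((\<Sum>i<r-1. smult (Pmat r $$ (i,j) * ?b i) (?v i)) * pderiv ?f)
      + (\<Sum>i<r-1. smult (Pmat r $$ (i,j) * mconst (of_int n / (of_nat r * of_int n - ?c i)))
          (smult (mconst (of_nat r / ?c i)) (pderiv (?v i) * ?f) - ?v i * pderiv ?f))"
    by (simp only: sum.distrib sum_subtractf sum_distrib_right smult_sum2)
  also have "(\<Sum>i<r-1. smult (Pmat r $$ (i,j) * ?b i) (?v i)) = primitive_pol r n j"
    by (simp only: primitive_pol_def)
  also have "(\<Sum>i<r-1. smult (Pmat r $$ (i,j) * ?b i) (pderiv (?v i))) = pderiv (primitive_pol r n j)"
    by (simp only: primitive_pol_def pderiv_sum pderiv_smult)
  also have "(\<Sum>i<r-1. smult (Pmat r $$ (i,j) * mconst (of_int n / (of_nat r * of_int n - ?c i)))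
          (smult (mconst (of_nat r / ?c i)) (pderiv (?v i) * ?f) - ?v i * pderiv ?f)) = remainder_pol r n j"
    unfolding remainder_pol_eq[OF r j]
    by (rule sum.cong[OF refl]) (simp only: Bmat_Qmat_poly[OF r] lessThan_iff)
  finally show ?thesis .
qed

subsection \<open>Reduction modulo p\<close>

lemma of_int_mod_ring_eq_0_iff:
  "(of_int b :: 'p::prime_card mod_ring) = 0 \<longleftrightarrow> int CARD('p) dvd b"
  using of_int_eq_0_iff_char_dvd[where 'a = "'p mod_ring"] by simp

text \<open>The definitions refer to lowest terms. The reduced denominator divides every other one,
  so any representation with denominator prime to \<open>p\<close> may be used.\<close>

lemma p_integral_quotient:
  assumes "\<not> int CARD('p::prime_card) dvd b"
  shows "p_integral (int CARD('p)) (of_int a / of_int b)"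
    and "(red_rat (of_int a / of_int b) :: 'p mod_ring) = of_int a / of_int b"
proof -
  obtain c d where cd: "quotient_of (of_int a / of_int b) = (c, d)"
    by (cases "quotient_of (of_int a / of_int b)")
  have b: "b \<noteq> 0"
    using assms by auto
  have d: "d > 0" "coprime c d"
    using quotient_of_denom_pos[OF cd] quotient_of_coprime[OF cd] .
  have "(of_int a / of_int b :: rat) = of_int c / of_int d"
    by (rule quotient_of_div[OF cd])
  then have "(of_int (a * d) :: rat) = of_int (c * b)"
    using b d by (simp add: field_simps)
  then have eq: "a * d = c * b"
    by (simp only: of_int_eq_iff)
  then have "d dvd c * b"
    by (metis dvd_triv_right)
  then have "d dvd b"
    using d by (simp add: coprime_dvd_mult_right_iff coprime_commute)
  then have nd: "\<not> int CARD('p) dvd d"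
    using assms dvd_trans by blast
  then show "p_integral (int CARD('p)) (of_int a / of_int b)"
    by (simp add: p_integral_def cd)
  have "(of_int a * of_int d :: 'p mod_ring) = of_int c * of_int b"
    using arg_cong[OF eq, of "of_int :: int \<Rightarrow> 'p mod_ring"] by simp
  moreover have "(of_int b :: 'p mod_ring) \<noteq> 0" "(of_int d :: 'p mod_ring) \<noteq> 0"
    using assms nd by (simp_all add: of_int_mod_ring_eq_0_iff)
  ultimately have "(of_int c / of_int d :: 'p mod_ring) = of_int a / of_int b"
    by (simp add: frac_eq_eq)
  then show "(red_rat (of_int a / of_int b) :: 'p mod_ring) = of_int a / of_int b"
    unfolding red_rat_def cd prod.case divide_inverse[symmetric] .
qed

lemma p_integral_cases:
  assumes "p_integral (int CARD('p::prime_card)) x"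
  obtains a b where "x = of_int a / of_int b" "\<not> int CARD('p) dvd b"
  using assms quotient_of_div[of x] by (cases "quotient_of x") (auto simp: p_integral_def)

lemma subring_hom_red_rat:
  "subring_hom {x. p_integral (int CARD('p::prime_card)) x} (red_rat :: rat \<Rightarrow> 'p mod_ring)"
proof
  note q = p_integral_quotient[where 'p = 'p]
  have one: "\<not> int CARD('p) dvd 1"
    using prime_card_int[where 'a = 'p] by (metis not_prime_unit)
  show "1 \<in> {x. p_integral (int CARD('p)) x}" "(red_rat 1 :: 'p mod_ring) = 1"
    using q[OF one, of 1] by simp_all
  fix x y assume x: "x \<in> {x. p_integral (int CARD('p)) x}"
  from x obtain a b where ab: "x = of_int a / of_int b" "\<not> int CARD('p) dvd b"
    using p_integral_cases[where 'p = 'p] by auto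
  show "- x \<in> {x. p_integral (int CARD('p)) x}"
    using q(1)[OF ab(2), of "- a"] by (simp add: ab(1))
  assume y: "y \<in> {x. p_integral (int CARD('p)) x}"
  from y obtain c d where cd: "y = of_int c / of_int d" "\<not> int CARD('p) dvd d"
    using p_integral_cases[where 'p = 'p] by auto
  have bd: "\<not> int CARD('p) dvd b * d"
    using ab cd prime_card_int[where 'a = 'p] by (simp add: prime_dvd_mult_iff)
  have ne: "b \<noteq> 0" "d \<noteq> 0"
    using ab cd by auto
  have ne': "(of_int b :: 'p mod_ring) \<noteq> 0" "(of_int d :: 'p mod_ring) \<noteq> 0"
    using ab cd by (simp_all add: of_int_mod_ring_eq_0_iff)
  have add: "x + y = of_int (a * d + c * b) / of_int (b * d)" and mult: "x * y = of_int (a * c) / of_int (b * d)"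
    using ne by (simp_all add: ab(1) cd(1) add_frac_eq)
  show "x + y \<in> {x. p_integral (int CARD('p)) x}" "x * y \<in> {x. p_integral (int CARD('p)) x}"
    unfolding add mult mem_Collect_eq by (rule q(1)[OF bd])+
  show "(red_rat (x + y) :: 'p mod_ring) = red_rat x + red_rat y"
    unfolding add q(2)[OF bd] unfolding ab(1) cd(1) q(2)[OF ab(2)] q(2)[OF cd(2)]
    using ne' by (simp add: add_frac_eq)
  show "(red_rat (x * y) :: 'p mod_ring) = red_rat x * red_rat y"
    unfolding mult q(2)[OF bd] unfolding ab(1) cd(1) q(2)[OF ab(2)] q(2)[OF cd(2)]
    by simp
qed

lemma red_mpol_eq: "red_mpol = Poly_Mapping.map red_rat"
  by (rule ext) (simp add: red_mpol_def)

lemma subring_hom_red_mpol: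
  "subring_hom {x. p_integral_mpol (int CARD('p::prime_card)) x} (red_mpol :: rat mpol \<Rightarrow> 'p mod_ring mpol)"
  using subring_hom.subring_hom_poly_mapping[OF subring_hom_red_rat[where 'p = 'p], where 'm = "nat \<Rightarrow>\<^sub>0 nat"]
  unfolding red_mpol_eq p_integral_mpol_def mem_Collect_eq .

section \<open>Integrality of the matrix entries at p\<close>

context
  fixes TP :: "'p::prime_card itself"
begin

interpretation Q: subring_hom "{x. p_integral (int CARD('p)) x}" "red_rat :: rat \<Rightarrow> 'p mod_ring"
  by (rule subring_hom_red_rat)

interpretation R: subring_hom "{x. p_integral_mpol (int CARD('p)) x}" "red_mpol :: rat mpol \<Rightarrow> 'p mod_ring mpol"
  by (rule subring_hom_red_mpol)

interpretation P: subring_hom "{q. \<forall>i. coeff q i \<in> {x. p_integral_mpol (int CARD('p)) x}}"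
  "map_poly (red_mpol :: rat mpol \<Rightarrow> 'p mod_ring mpol)"
  by (rule R.subring_hom_poly)

lemma p_integral_inverse:
  assumes "\<not> int CARD('p) dvd b"
  shows "p_integral (int CARD('p)) (1 / of_int b)"
  using p_integral_quotient(1)[OF assms, of 1] by simp

lemma p_integral_mult: "p_integral (int CARD('p)) x \<Longrightarrow> p_integral (int CARD('p)) y \<Longrightarrow>
    p_integral (int CARD('p)) (x * y)"
  using Q.mult_mem by simp

lemma p_integral_mpol_mconst: "p_integral (int CARD('p)) x \<Longrightarrow> p_integral_mpol (int CARD('p)) (mconst x)"
  using Q.zero_mem by (auto simp: p_integral_mpol_def mconst_def lookup_single when_def)

lemma p_integral_1: "p_integral (int CARD('p)) 1" and p_integral_0: "p_integral (int CARD('p)) 0"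
  using Q.one_mem Q.zero_mem by auto

lemma p_integral_mpol_mvar: "p_integral_mpol (int CARD('p)) (mvar k)"
  by (auto simp: p_integral_mpol_def mvar_def lookup_single when_def p_integral_1 p_integral_0)

lemma red_mpol_mvar: "red_mpol (mvar k) = (mvar k :: 'p mod_ring mpol)"
  by (rule poly_mapping_eqI)
     (simp add: red_mpol_def mvar_def Poly_Mapping.map.rep_eq lookup_single when_def Q.h_one Q.h_zero)

lemma p_integral_mpol_fpol: "p_integral_mpol (int CARD('p)) (coeff (fpol r) i)"
  using R.one_mem R.zero_mem by (simp add: coeff_fpol p_integral_mpol_mvar)

lemma map_poly_red_fpol: "map_poly red_mpol (fpol r) = (fpol r :: 'p mod_ring mpol poly)"
  by (rule poly_eqI) (simp add: coeff_map_poly coeff_fpol R.h_zero R.h_one red_mpol_mvar)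

text \<open>The only new denominator is \<open>k!\<close>, prime to \<open>p\<close> for
  \<open>k < p\<close>; the indices met below are all less than \<open>r < p\<close>.\<close>

lemma p_integral_gbinomial:
  assumes "p_integral (int CARD('p)) x" "k < CARD('p)"
  shows "p_integral (int CARD('p)) (x gchoose k)"
proof -
  have "\<not> CARD('p) dvd fact k"
    using assms(2) prime_card[where 'a = 'p] by (simp add: prime_dvd_fact_iff)
  then have "\<not> int CARD('p) dvd int (fact k)"
    unfolding int_dvd_int_iff .
  from p_integral_inverse[OF this] have f: "p_integral (int CARD('p)) (1 / fact k)"
    by simp
  have "(\<Prod>i=0..<k. x - of_nat i) \<in> {x. p_integral (int CARD('p)) x}"
    by (intro Q.prod_mem Q.diff_mem Q.of_nat_mem) (use assms in simp)
  then have "p_integral (int CARD('p)) ((\<Prod>i=0..<k. x - of_nat i) * (1 / fact k))"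
    using f by (simp only: mem_Collect_eq p_integral_mult)
  then show ?thesis
    by (simp add: gbinomial_prod_rev)
qed

lemma p_integral_mpol_phi_coeff:
  assumes "p_integral (int CARD('p)) lam" "l < CARD('p)"
  shows "p_integral_mpol (int CARD('p)) (phi_coeff r lam l)"
proof -
  have psi: "psi_pol r ^ k \<in> {q. \<forall>i. coeff q i \<in> {x. p_integral_mpol (int CARD('p)) x}}" for k
    by (rule P.power_mem) (use R.zero_mem in \<open>simp add: coeff_psi_pol p_integral_mpol_mvar\<close>)
  have "(\<Sum>k\<le>l. mconst (lam gchoose k) * coeff (psi_pol r ^ k) l) \<in> {x. p_integral_mpol (int CARD('p)) x}"
  proof (intro R.sum_mem R.mult_mem)
    fix k assume "k \<in> {..l}"
    then show "mconst (lam gchoose k) \<in> {x. p_integral_mpol (int CARD('p)) x}"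
      using assms by (auto intro!: p_integral_mpol_mconst p_integral_gbinomial)
    show "coeff (psi_pol r ^ k) l \<in> {x. p_integral_mpol (int CARD('p)) x}"
      using psi[of k] by auto
  qed
  then show ?thesis
    by (simp add: beta_nat[symmetric] beta_def)
qed

context
  fixes r :: nat and n :: int
  assumes r: "2 \<le> r" "r < CARD('p)" and n: "1 \<le> n" "int r * n < int CARD('p)"
begin

lemma p_not_dvd_small: "0 < b \<Longrightarrow> b < int CARD('p) \<Longrightarrow> \<not> int CARD('p) dvd b"
  using zdvd_imp_le by fastforce

lemma p_integral_div_r: "p_integral (int CARD('p)) (of_int a / of_nat r)"
  using p_integral_quotient(1)[OF p_not_dvd_small[of "int r"], of a] r by simp

text \<open>From \<open>n >= 1\<close> follows \<open>rn >= r > r-1-i\<close>, and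
  \<open>rn < p\<close>; so \<open>D\<close> lies strictly between 0 and \<open>p\<close>.\<close>

lemma denominator:
  assumes "i < r - 1"
  defines "D \<equiv> int r * n - int (r - 1 - i)"
  shows "0 < D" "\<not> int CARD('p) dvd D"
proof -
  have "int r * 1 \<le> int r * n"
    using n by (intro mult_left_mono) auto
  then show "0 < D"
    using assms by (simp add: D_def of_nat_diff)
  then show "\<not> int CARD('p) dvd D"
    by (rule p_not_dvd_small) (use n in \<open>simp add: D_def\<close>)
qed

lemma p_integral_mpol_Pmat:
  assumes "i < r - 1" "j < r - 1"
  shows "p_integral_mpol (int CARD('p)) (Pmat r $$ (i,j))"
proof -
  have "p_integral (int CARD('p)) (- of_nat (r - 1 - i) / of_nat r)"
    using p_integral_div_r[of "- int (r - 1 - i)"] by simp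
  then show ?thesis
    unfolding Pmat_index[OF assms] using assms r R.zero_mem by (simp add: p_integral_mpol_phi_coeff)
qed

lemma p_integral_mpol_Qmat:
  assumes "i < r - 1" "j < r - 1"
  shows "p_integral_mpol (int CARD('p)) (Qmat r $$ (i,j))"
proof -
  have "p_integral (int CARD('p)) (- of_nat (Suc j) / of_nat r)"
    using p_integral_div_r[of "- int (Suc j)"] by simp
  then show ?thesis
    unfolding Qmat_index[OF assms] using assms r R.zero_mem by (simp add: p_integral_mpol_phi_coeff del: of_nat_Suc)
qed

lemma p_integral_mpol_Zmat:
  assumes "i < r - 1" "j < r - 1"
  shows "p_integral_mpol (int CARD('p)) (Zmat r n $$ (i,j))"
proof -
  have "p_integral (int CARD('p)) (of_int n / of_int (int r * n - int (r - 1 - i)))"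
    by (rule p_integral_quotient(1)[OF denominator(2)[OF assms(1)]])
  moreover have "(of_int (int r * n - int (r - 1 - i)) :: rat) = of_nat r * of_int n - (of_nat r - of_nat (i + 1))"
    using assms by (simp add: of_nat_diff)
  ultimately show ?thesis
    using assms R.zero_mem by (auto simp: Zmat_def intro!: p_integral_mpol_mconst)
qed

text \<open>Through \<open>bez_poly\<close> the entries arise from \<open>f'\<close> and
  \<open>Bez_G r\<close> by shifts, products and differences, so \<open>r\<close> is the only
  denominator.\<close>

lemma p_integral_mpol_Bmat:
  assumes "i < r - 1" "j < r - 1"
  shows "p_integral_mpol (int CARD('p)) (Bmat r $$ (i,j))"
proof -
  let ?S = "{q. \<forall>i. coeff q i \<in> {x. p_integral_mpol (int CARD('p)) x}}"
  have F: "Bez_F r \<in> ?S"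
    using R.mult_mem[OF R.of_nat_mem] p_integral_mpol_fpol by (simp only: coeff_Bez_F mem_Collect_eq) blast
  have "p_integral (int CARD('p)) (1 - of_nat t / of_nat r)" for t
    using Q.diff_mem[OF Q.one_mem, of "of_nat t / of_nat r"] p_integral_div_r[of "int t"] by simp
  then have G: "Bez_G r \<in> ?S"
    using R.mult_mem p_integral_mpol_fpol p_integral_mpol_mconst by (simp only: coeff_Bez_G mem_Collect_eq) blast
  have shift: "poly_shift k q \<in> ?S" if "q \<in> ?S" for k q
    using that by (simp add: coeff_poly_shift)
  have "bez_poly (Bez_F r) (Bez_G r) (r - 1 - i) \<in> ?S"
    unfolding bez_poly_def by (intro P.diff_mem P.mult_mem shift F G)
  then show ?thesis
    by (simp only: Bmat_index[OF r(1) assms] mem_Collect_eq)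
qed

lemma p_integral_mats:
  "p_integral_mat (int CARD('p)) (Bmat r)" "p_integral_mat (int CARD('p)) (Qmat r)"
  "p_integral_mat (int CARD('p)) (Zmat r n)" "p_integral_mat (int CARD('p)) (Pmat r)"
  using p_integral_mpol_Bmat p_integral_mpol_Qmat p_integral_mpol_Zmat p_integral_mpol_Pmat
    Bmat_carrier[OF r(1)] Qmat_carrier[of r] Zmat_carrier[of r n] Pmat_carrier[of r]
  unfolding p_integral_mat_def by auto

lemma red_mat_product:
  "red_mat (Bmat r * Qmat r * Zmat r n * Pmat r) =
    (red_mat (Bmat r) * red_mat (Qmat r) * red_mat (Zmat r n) * red_mat (Pmat r) :: 'p mod_ring mpol mat)"
  and p_integral_mpol_product: "\<And>i j. i < r - 1 \<Longrightarrow> j < r - 1 \<Longrightarrow>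
    p_integral_mpol (int CARD('p)) ((Bmat r * Qmat r * Zmat r n * Pmat r) $$ (i,j))"
proof -
  let ?m = "r - 1"
  have BQ: "Bmat r * Qmat r \<in> carrier_mat ?m ?m"
    using Bmat_carrier[OF r(1)] Qmat_carrier by (rule mult_carrier_mat)
  have BQZ: "Bmat r * Qmat r * Zmat r n \<in> carrier_mat ?m ?m"
    using BQ Zmat_carrier by (rule mult_carrier_mat)
  have iBQ: "p_integral_mpol (int CARD('p)) ((Bmat r * Qmat r) $$ (i,j))" if "i < ?m" "j < ?m" for i j
    using R.mult_mat_mem[OF Bmat_carrier[OF r(1)] Qmat_carrier _ _ that] p_integral_mpol_Bmat p_integral_mpol_Qmat by auto
  have iBQZ: "p_integral_mpol (int CARD('p)) ((Bmat r * Qmat r * Zmat r n) $$ (i,j))" if "i < ?m" "j < ?m" for i j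
    using R.mult_mat_mem[OF BQ Zmat_carrier _ _ that] iBQ p_integral_mpol_Zmat by auto
  show "p_integral_mpol (int CARD('p)) ((Bmat r * Qmat r * Zmat r n * Pmat r) $$ (i,j))" if "i < ?m" "j < ?m" for i j
    using R.mult_mat_mem[OF BQZ Pmat_carrier _ _ that] iBQZ p_integral_mpol_Pmat by auto
  have 1: "red_mat (Bmat r * Qmat r) = (red_mat (Bmat r) * red_mat (Qmat r) :: 'p mod_ring mpol mat)"
    unfolding red_mat_def using p_integral_mpol_Bmat p_integral_mpol_Qmat
    by (intro R.map_mat_mult[OF Bmat_carrier[OF r(1)] Qmat_carrier]) auto
  have 2: "red_mat (Bmat r * Qmat r * Zmat r n) =
      (red_mat (Bmat r * Qmat r) * red_mat (Zmat r n) :: 'p mod_ring mpol mat)"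
    unfolding red_mat_def using iBQ p_integral_mpol_Zmat by (intro R.map_mat_mult[OF BQ Zmat_carrier]) auto
  have 3: "red_mat (Bmat r * Qmat r * Zmat r n * Pmat r) =
      (red_mat (Bmat r * Qmat r * Zmat r n) * red_mat (Pmat r) :: 'p mod_ring mpol mat)"
    unfolding red_mat_def using iBQZ p_integral_mpol_Pmat by (intro R.map_mat_mult[OF BQZ Pmat_carrier]) auto
  show "red_mat (Bmat r * Qmat r * Zmat r n * Pmat r) =
    (red_mat (Bmat r) * red_mat (Qmat r) * red_mat (Zmat r n) * red_mat (Pmat r) :: 'p mod_ring mpol mat)"
    unfolding 3 2 1 ..
qed

lemma p_integral_mpol_primitive_pol:
  assumes j: "j < r - 1"
  shows "p_integral_mpol (int CARD('p)) (coeff (primitive_pol r n j) t)"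
proof -
  have "coeff (vpol r i) t \<in> {x. p_integral_mpol (int CARD('p)) x}" if "i < r - 1" for i
    using p_integral_div_r[of "int (r - 1 - i)"] that r R.zero_mem
    by (auto simp: coeff_vpol intro!: p_integral_mpol_phi_coeff)
  moreover have "mconst (1 / (of_nat (r - 1 - i) - of_nat r * of_int n)) \<in> {x. p_integral_mpol (int CARD('p)) x}"
    if "i < r - 1" for i
  proof -
    have "\<not> int CARD('p) dvd - (int r * n - int (r - 1 - i))"
      using denominator(2)[OF that] by (simp only: dvd_minus_iff) simp
    from p_integral_inverse[OF this] show ?thesis
      by (simp add: p_integral_mpol_mconst del: of_nat_diff)
  qed
  moreover have "Pmat r $$ (i,j) \<in> {x. p_integral_mpol (int CARD('p)) x}" if "i < r - 1" for i
    using p_integral_mpol_Pmat[OF that j] by simp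
  ultimately have "(\<Sum>i<r-1. Pmat r $$ (i,j) * mconst (1 / (of_nat (r - 1 - i) - of_nat r * of_int n)) *
      coeff (vpol r i) t) \<in> {x. p_integral_mpol (int CARD('p)) x}"
    by (intro R.sum_mem R.mult_mem) (simp_all only: lessThan_iff)
  then show ?thesis
    by (simp only: primitive_pol_def coeff_sum coeff_smult mem_Collect_eq)
qed

text \<open>All polynomials in \<open>reduction_identity\<close> are \<open>p\<close>-integral, so
  it can be reduced coefficientwise. The witness is the reduction of
  \<open>primitive_pol r n j\<close>; later it enters only through a derivative.\<close>

lemma reduction_identity_mod_p:
  assumes j: "j < r - 1"
  shows "\<exists>v. monom 1 (r - 2 - j) * (fpol r :: 'p mod_ring mpol poly) =
    pderiv v * fpol r - of_int n * (v * pderiv (fpol r)) +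
    (\<Sum>b<r-1. monom ((red_mat (Bmat r) * red_mat (Qmat r) * red_mat (Zmat r n) * red_mat (Pmat r)) $$ (b,j))
      (r - 1 - 1 - b))"
proof -
  let ?S = "{q. \<forall>i. coeff q i \<in> {x. p_integral_mpol (int CARD('p)) x}}"
  let ?h = "red_mpol :: rat mpol \<Rightarrow> 'p mod_ring mpol"
  let ?H = "map_poly ?h"
  let ?v = "primitive_pol r n j" and ?g = "remainder_pol r n j"
  let ?M = "Bmat r * Qmat r * Zmat r n * Pmat r"
  have nz: "(of_nat (r - 1 - i) - of_nat r * of_int n :: rat) \<noteq> 0" if "i < r - 1" for i
  proof -
    have "(of_int (int r * n - int (r - 1 - i)) :: rat) > 0"
      using denominator(1)[OF that] by (simp only: of_int_0_less_iff)
    then show ?thesis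
      by (simp del: of_nat_diff)
  qed
  have f: "fpol r \<in> ?S"
    using p_integral_mpol_fpol by simp
  have f': "pderiv (fpol r) \<in> ?S"
    using R.mult_mem[OF R.of_nat_mem] p_integral_mpol_fpol by (simp only: coeff_Bez_F mem_Collect_eq) blast
  have v: "?v \<in> ?S"
    using p_integral_mpol_primitive_pol[OF j] by simp
  have v': "pderiv ?v \<in> ?S"
    using R.mult_mem[OF R.of_nat_mem] p_integral_mpol_primitive_pol[OF j]
    by (simp only: coeff_pderiv mem_Collect_eq) blast
  have monom_mem: "monom x k \<in> ?S" if "p_integral_mpol (int CARD('p)) x" for x k
    using that R.zero_mem by simp
  have H_monom: "?H (monom x k) = monom (?h x) k" for x k
    by (rule poly_eqI) (simp add: coeff_map_poly R.h_zero)
  have one: "p_integral_mpol (int CARD('p)) 1"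
    using R.one_mem by simp
  have g_mem: "monom (?M $$ (b,j)) k \<in> ?S" if "b < r - 1" for b k
    by (rule monom_mem[OF p_integral_mpol_product[OF that j]])
  have g: "?g \<in> ?S"
    unfolding remainder_pol_def by (intro P.sum_mem g_mem) simp
  have carrier: "?M \<in> carrier_mat (r - 1) (r - 1)"
    using Bmat_carrier[OF r(1)] Qmat_carrier[of r] Zmat_carrier[of r n] Pmat_carrier[of r]
    by (intro mult_carrier_mat) auto
  have "?H ?g = (\<Sum>b<r-1. monom (?h (?M $$ (b,j))) (r - 1 - 1 - b))"
    unfolding remainder_pol_def by (subst P.h_sum, rule g_mem) (simp_all only: lessThan_iff H_monom)
  also have "\<dots> = (\<Sum>b<r-1. monom (red_mat ?M $$ (b,j)) (r - 1 - 1 - b))"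
  proof (rule sum.cong[OF refl])
    have "map_mat ?h A $$ (b,j) = ?h (A $$ (b,j))" if "A \<in> carrier_mat (r - 1) (r - 1)" "b < r - 1" for A b
      using that j by auto
    then show "monom (?h (?M $$ (b,j))) (r - 1 - 1 - b) = monom (red_mat ?M $$ (b,j)) (r - 1 - 1 - b)"
      if "b \<in> {..<r-1}" for b
      using that carrier by (simp only: red_mat_def lessThan_iff)
  qed
  finally have Hg: "?H ?g = (\<Sum>b<r-1. monom ((red_mat (Bmat r) * red_mat (Qmat r) * red_mat (Zmat r n) *
      red_mat (Pmat r)) $$ (b,j)) (r - 1 - 1 - b))"
    unfolding red_mat_product .
  have smult_n: "smult (of_int n) q = of_int n * q" for q :: "rat mpol poly"
    by (simp add: of_int_poly)
  have "monom 1 (r - 2 - j) * fpol r = pderiv ?v * fpol r - of_int n * (?v * pderiv (fpol r)) + ?g"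
    unfolding smult_n[symmetric] by (rule reduction_identity[OF r(1) j nz])
  then have "?H (monom 1 (r - 2 - j) * fpol r) =
      ?H (pderiv ?v * fpol r - of_int n * (?v * pderiv (fpol r)) + ?g)"
    by (rule arg_cong)
  then have "?H (monom 1 (r - 2 - j)) * ?H (fpol r) =
      ?H (pderiv ?v) * ?H (fpol r) - of_int n * (?H ?v * ?H (pderiv (fpol r))) + ?H ?g"
    using f f' v v' g monom_mem[OF one]
    by (simp only: P.h_mult P.h_add P.h_diff P.h_of_int P.mult_mem P.add_mem P.diff_mem P.of_int_mem)
  then have "monom 1 (r - 2 - j) * (fpol r :: 'p mod_ring mpol poly) =
      pderiv (?H ?v) * fpol r - of_int n * (?H ?v * pderiv (fpol r)) + ?H ?g"
    using R.map_poly_pderiv[of "fpol r"] R.map_poly_pderiv[of ?v] f v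
    by (simp only: H_monom R.h_one map_poly_red_fpol mem_Collect_eq)
  then show ?thesis
    unfolding Hg by blast
qed

end

end

subsection \<open>The matrices of coefficients of powers of f\<close>

text \<open>For \<open>r \<le> p\<close> the exponent is never negative, so the default value 0 in
  \<open>Mmat\<close> does not occur.\<close>

lemma Mmat_index:
  assumes "2 \<le> r" "r \<le> CARD('p::prime_card)" "i < r - 1" "j < r - 1"
  shows "(Mmat r (r - 1) k :: 'p mod_ring mpol mat) $$ (i,j) = coeff (fpol r ^ k) ((i + 1) * CARD('p) + (j + 1) - r)"
proof -
  have "r \<le> (i + 1) * CARD('p) + (j + 1)"
    using assms(2) by simp
  then have "int ((i + 1) * CARD('p) + (j + 1)) - int (r - 1) - 1 = int ((i + 1) * CARD('p) + (j + 1) - r)"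
    using assms(1) by (simp add: of_nat_diff)
  then show ?thesis
    using assms(3,4) unfolding Mmat_def by (simp only: index_mat(1) Let_def prod.case) simp
qed

lemma Mmat_carrier: "Mmat r d k \<in> carrier_mat d d"
  by (simp add: Mmat_def)

lemma Mmat_Suc:
  fixes r e :: nat and n :: int
  assumes r: "2 \<le> r" "r < CARD('p::prime_card)" and n: "1 \<le> n" "int r * n < int CARD('p)"
    and e: "int e + 1 + n = int CARD('p)"
  shows "Mmat r (r - 1) (Suc e) = (Mmat r (r - 1) e *
    (red_mat (Bmat r) * red_mat (Qmat r) * red_mat (Zmat r n) * red_mat (Pmat r)) :: 'p mod_ring mpol mat)"
    (is "_ = _ * ?R")
proof (rule eq_matI)
  have R: "?R \<in> carrier_mat (r - 1) (r - 1)"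
    using Bmat_carrier[OF r(1)] Qmat_carrier[of r] Zmat_carrier[of r n] Pmat_carrier[of r]
    unfolding red_mat_def by (intro mult_carrier_mat[of _ _ "r - 1"]) auto
  note MR = mult_carrier_mat[OF Mmat_carrier[of r "r - 1" e] R]
  note dims = carrier_matD[OF Mmat_carrier[where 'a = 'p, of r "r - 1" "Suc e"]] carrier_matD[OF MR]
  show "dim_row (Mmat r (r - 1) (Suc e) :: 'p mod_ring mpol mat) = dim_row (Mmat r (r - 1) e * ?R)"
    "dim_col (Mmat r (r - 1) (Suc e) :: 'p mod_ring mpol mat) = dim_col (Mmat r (r - 1) e * ?R)"
    by (simp_all only: dims)
  fix i j assume "i < dim_row (Mmat r (r - 1) e * ?R)" "j < dim_col (Mmat r (r - 1) e * ?R)"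
  then have i: "i < r - 1" and j: "j < r - 1"
    by (simp_all only: dims)
  let ?f = "fpol r :: 'p mod_ring mpol poly"
  let ?g = "\<Sum>b<r-1. monom (?R $$ (b,j)) (r - 1 - 1 - b)"
  \<comment> \<open>At this exponent a derivative carries the factor \<open>(i+1) p\<close>, which
    is zero in characteristic \<open>p\<close>.\<close>
  let ?N = "(i + 1) * CARD('p) - 1"
  have N: "Suc ?N = (i + 1) * CARD('p)"
    by simp
  have p0: "(of_nat (CARD('p) * k) :: 'p mod_ring mpol) = 0" for k
  proof -
    have "(of_nat CARD('p) :: 'p mod_ring mpol) = Poly_Mapping.single 0 (of_nat CARD('p))"
      by (simp only: single_of_nat)
    also have "\<dots> = 0"
      by (simp only: of_nat_card_eq_0 single_zero)
    finally show ?thesis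
      by simp
  qed
  obtain v where v: "monom 1 (r - 2 - j) * ?f = pderiv v * ?f - of_int n * (v * pderiv ?f) + ?g"
    using reduction_identity_mod_p[OF r n j] by blast
  \<comment> \<open>\<open>e + 1 + n = p\<close> becomes \<open>n = -(e+1)\<close>.\<close>
  have "of_int (int e + 1 + n) = (0 :: 'p mod_ring mpol)"
    unfolding e using p0[of 1] by simp
  then have "of_int n = - (of_nat (Suc e) :: 'p mod_ring mpol)"
    by (simp add: add_eq_0_iff2 add.commute)
  then have n': "(of_int n :: 'p mod_ring mpol poly) = - [:of_nat (Suc e):]"
    by (simp add: of_int_poly)
  have "monom 1 (r - 2 - j) * ?f ^ Suc e = (monom 1 (r - 2 - j) * ?f) * ?f ^ e"
    by (simp only: power_Suc mult.assoc)
  \<comment> \<open>The term \<open>-n v f' f^e = (e+1) v f' f^e\<close> is \<open>v\<close> times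
    the derivative of \<open>f^(e+1)\<close>, so the terms in \<open>v\<close> combine to one
    derivative.\<close>
  also have "\<dots> = pderiv v * ?f ^ Suc e + v * pderiv (?f ^ Suc e) + ?g * ?f ^ e"
  proof -
    have "(V' * F - (- c) * (V * F') + G) * E = V' * (F * E) + V * (c * (F' * E)) + G * E"
      for V' F c V F' G E :: "'p mod_ring mpol poly"
      by (simp add: algebra_simps)
    from this[of "pderiv v" ?f "[:of_nat (Suc e):]" v "pderiv ?f" ?g "?f ^ e"]
    show ?thesis
      unfolding v n' pderiv_power_Suc by (simp add: mult.commute)
  qed
  also have "\<dots> = pderiv (v * ?f ^ Suc e) + ?g * ?f ^ e"
    by (simp add: pderiv_mult algebra_simps)
  finally have key: "monom 1 (r - 2 - j) * ?f ^ Suc e = pderiv (v * ?f ^ Suc e) + ?g * ?f ^ e" .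
  \<comment> \<open>Multiplication by \<open>x^(r-2-k)\<close> moves the exponent of column
    \<open>k\<close> of row \<open>i\<close> to \<open>?N\<close>, the same for all columns.\<close>
  have shift: "coeff (monom c (r - 2 - k) * q) ?N = c * coeff q ((i + 1) * CARD('p) + (k + 1) - r)"
    if "k < r - 1" for c q and k
  proof -
    have "CARD('p) \<le> (i + 1) * CARD('p)"
      by simp
    then have le: "r \<le> (i + 1) * CARD('p)"
      using r(2) by linarith
    have "?N - (r - 2 - k) = (i + 1) * CARD('p) + (k + 1) - r" "r - 2 - k \<le> ?N"
      using le that by linarith+
    then show ?thesis
      by (simp only: coeff_monom_mult if_True)
  qed
  have "coeff (pderiv q) ?N = 0" for q :: "'p mod_ring mpol poly"
    unfolding coeff_pderiv N using p0[of "i + 1"] by (simp only: mult.commute[of "i + 1"] mult_zero_left)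
  then have "coeff (monom 1 (r - 2 - j) * ?f ^ Suc e) ?N = coeff (?g * ?f ^ e) ?N"
    unfolding key by simp
  also have "\<dots> = (\<Sum>b<r-1. ?R $$ (b,j) * coeff (?f ^ e) ((i + 1) * CARD('p) + (b + 1) - r))"
    unfolding sum_distrib_right coeff_sum
  proof (rule sum.cong[OF refl])
    fix b assume "b \<in> {..<r-1}"
    then have b: "b < r - 1" by simp
    have "r - 1 - 1 - b = r - 2 - b" by simp
    then show "coeff (monom (?R $$ (b,j)) (r - 1 - 1 - b) * ?f ^ e) ?N =
        ?R $$ (b,j) * coeff (?f ^ e) ((i + 1) * CARD('p) + (b + 1) - r)"
      by (simp only: shift[OF b])
  qed
  also have "\<dots> = (\<Sum>b<r-1. Mmat r (r - 1) e $$ (i,b) * ?R $$ (b,j))"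
    by (rule sum.cong[OF refl])
       (simp only: Mmat_index[OF r(1) less_imp_le[OF r(2)] i] lessThan_iff mult.commute)
  also have "\<dots> = (Mmat r (r - 1) e * ?R) $$ (i,j)"
    by (rule sum_mat_index[OF Mmat_carrier R i j, symmetric])
  finally have "coeff (?f ^ Suc e) ((i + 1) * CARD('p) + (j + 1) - r) = (Mmat r (r - 1) e * ?R) $$ (i,j)"
    by (simp only: shift[OF j] mult_1_left)
  then show "Mmat r (r - 1) (Suc e) $$ (i,j) = (Mmat r (r - 1) e * ?R) $$ (i,j)"
    by (simp only: Mmat_index[OF r(1) less_imp_le[OF r(2)] i j])
qed

section \<open>Nonsingularity by specialization to \<open>x^r + 1\<close>\<close>

text \<open>The substitution \<open>s\<^sub>r = 1\<close> and \<open>s\<^sub>k = 0\<close> for \<open>k \<noteq> r\<close>.\<close>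

definition eval_last :: "nat \<Rightarrow> 'a::comm_ring_1 mpol \<Rightarrow> 'a" where
  "eval_last r a = (\<Sum>m\<in>Poly_Mapping.keys a.
     if \<forall>k. k \<noteq> r \<longrightarrow> Poly_Mapping.lookup m k = 0 then Poly_Mapping.lookup a m else 0)"

lemma eval_last_single:
  "eval_last r (Poly_Mapping.single m c) = (if \<forall>k. k \<noteq> r \<longrightarrow> Poly_Mapping.lookup m k = 0 then c else 0)"
  by (auto simp: eval_last_def)

lemma eval_last_add: "eval_last r (a + b) = eval_last r a + eval_last r b"
  unfolding eval_last_def
  by (rule setsum_keys_plus_distrib
      [where f = "\<lambda>m x. if \<forall>k. k \<noteq> r \<longrightarrow> Poly_Mapping.lookup m k = 0 then x else 0"]) auto

text \<open>A product of monomials involves only the variable \<open>r\<close> iff both factors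
  do.\<close>

lemma eval_last_mult: "eval_last r (a * b) = eval_last r a * eval_last r b"
proof (rule poly_mapping_hom_mult[where S = UNIV])
  fix k l :: "nat \<Rightarrow>\<^sub>0 nat" and x y :: 'a
  show "eval_last r (Poly_Mapping.single (k + l) (x * y)) =
    eval_last r (Poly_Mapping.single k x) * eval_last r (Poly_Mapping.single l y)"
    by (auto simp: eval_last_single lookup_add)
qed (simp_all add: eval_last_add)

lemma comm_ring_hom_eval_last: "comm_ring_hom (eval_last r :: 'a::comm_ring_1 mpol \<Rightarrow> 'a)"
proof
  show "eval_last r (0 :: 'a mpol) = 0"
    by (simp add: eval_last_def)
  show "eval_last r (1 :: 'a mpol) = 1"
    using eval_last_single[of r 0 1] by simp
qed (simp_all add: eval_last_add eval_last_mult)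

lemma eval_last_fpol:
  assumes "r > 0"
  shows "map_poly (eval_last r) (fpol r) = (monom 1 r + 1 :: 'a::comm_ring_1 poly)"
proof -
  interpret comm_ring_hom "eval_last r :: 'a mpol \<Rightarrow> 'a"
    by (rule comm_ring_hom_eval_last)
  have "eval_last r (mvar k :: 'a mpol) = (if k = r then 1 else 0)" for k
    by (auto simp: mvar_def eval_last_single lookup_single when_def)
  then show ?thesis
    using assms by (auto simp: poly_eq_iff coeff_map_poly coeff_fpol coeff_1)
qed

lemma coeff_monom_plus_1_power:
  assumes "r > 0"
  shows "coeff ((monom 1 r + 1 :: 'a::comm_ring_1 poly) ^ e) t = (if r dvd t then of_nat (e choose (t div r)) else 0)"
proof -
  have "(monom 1 r + 1 :: 'a poly) ^ e = (\<Sum>k\<le>e. of_nat (e choose k) * monom 1 r ^ k)"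
    by (simp add: binomial_ring)
  also have "\<dots> = (\<Sum>k\<le>e. monom (of_nat (e choose k)) (r * k))"
    by (rule sum.cong) (simp_all add: monom_power of_nat_poly smult_monom)
  finally have "coeff ((monom 1 r + 1 :: 'a poly) ^ e) t = (\<Sum>k\<le>e. if r * k = t then of_nat (e choose k) else 0)"
    by (simp add: coeff_sum)
  also have "\<dots> = (if r dvd t then of_nat (e choose (t div r)) else 0)"
  proof (cases "r dvd t")
    case True
    then have "(r * k = t) = (k = t div r)" for k
      using assms by auto
    then show ?thesis
      using True by (simp add: binomial_eq_0)
  next
    case False
    then have "r * k \<noteq> t" for k
      by auto
    then show ?thesis
      using False by simp
  qed
  finally show ?thesis .
qed

text \<open>Powers of \<open>x^r + 1\<close> have only exponents divisible by \<open>r\<close>, so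
  this locates the one possible nonzero entry of a row. Since \<open>p\<close> is prime to
  \<open>r\<close> and \<open>0 < i+1 < r\<close>, the residue \<open>m\<close> is nonzero; then
  \<open>m + j + 1\<close> lies strictly between 0 and \<open>2r\<close> and must be
  \<open>r\<close>.\<close>

lemma row_match_unique:
  assumes "i < r - 1" "r < CARD('p::prime_card)" "j < r - 1"
  shows "r dvd (i + 1) * CARD('p) + (j + 1) \<longleftrightarrow> j = r - 1 - (i + 1) * CARD('p) mod r"
    and "(i + 1) * CARD('p) mod r \<noteq> 0"
proof -
  define m where "m = (i + 1) * CARD('p) mod r"
  have r: "0 < r" using assms by simp
  have "\<not> CARD('p) dvd r"
    using assms(2) r by (auto dest: dvd_imp_le)
  then have cop: "coprime CARD('p) r"
    using prime_card[where 'a = 'p] by (intro prime_imp_coprime) auto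
  have "\<not> r dvd i + 1"
    using assms(1) by (auto dest: dvd_imp_le)
  then have "\<not> r dvd (i + 1) * CARD('p)"
    using cop by (metis coprime_commute coprime_dvd_mult_left_iff)
  then show "(i + 1) * CARD('p) mod r \<noteq> 0"
    by (simp only: dvd_eq_mod_eq_0 simp_thms)
  then have m: "0 < m" "m < r"
    using r by (simp_all add: m_def)
  have "r dvd (i + 1) * CARD('p) + (j + 1) \<longleftrightarrow> (m + (j + 1)) mod r = 0"
    unfolding m_def by (simp only: mod_add_left_eq dvd_eq_mod_eq_0)
  also have "\<dots> \<longleftrightarrow> m + (j + 1) = r"
  proof
    assume "(m + (j + 1)) mod r = 0"
    then obtain k where k: "m + (j + 1) = r * k"
      by (auto simp: mod_eq_0_iff_dvd elim: dvdE)
    have "r * k < r * 2" "r * 0 < r * k"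
      using m assms unfolding k[symmetric] by auto
    then have "k = 1"
      using r unfolding nat_mult_less_cancel1[OF r] by simp
    then show "m + (j + 1) = r"
      using k by simp
  qed simp
  also have "\<dots> \<longleftrightarrow> j = r - 1 - m"
    using m assms(3) by auto
  finally show "r dvd (i + 1) * CARD('p) + (j + 1) \<longleftrightarrow> j = r - 1 - (i + 1) * CARD('p) mod r"
    unfolding m_def .
qed

text \<open>A determinant that survives a specialization is nonzero. For \<open>x^r + 1\<close> each
  row has one entry, a binomial coefficient of \<open>e\<close>, in a column of its own; the bounds
  on \<open>e\<close> keep these coefficients prime to \<open>p\<close>.\<close>

lemma det_Mmat_nonzero:
  fixes r e :: nat
  assumes r: "2 \<le> r" "r < CARD('p::prime_card)"
    and e: "e < CARD('p)" "r * CARD('p) < r * (e + 1) + CARD('p)"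
  shows "det (Mmat r (r - 1) e :: 'p mod_ring mpol mat) \<noteq> 0"
proof
  let ?m = "r - 1" and ?p = "CARD('p)"
  let ?ev = "eval_last r :: 'p mod_ring mpol \<Rightarrow> 'p mod_ring"
  let ?M = "Mmat r ?m e :: 'p mod_ring mpol mat"
  interpret comm_ring_hom ?ev
    by (rule comm_ring_hom_eval_last)
  interpret H: map_poly_comm_ring_hom ?ev ..
  define J where "J i = r - 1 - (i + 1) * ?p mod r" for i
  define W where "W = map_mat ?ev ?M"
  have W_carrier: "W \<in> carrier_mat ?m ?m"
    by (simp add: W_def Mmat_carrier)
  have J_less: "J i < ?m" if "i < ?m" for i
    using row_match_unique(2)[where 'p = 'p, OF that r(2) that] r that by (auto simp: J_def)
  have W_index: "W $$ (i,j) = (if j = J i then of_nat (e choose (((i + 1) * ?p + (j + 1) - r) div r)) else 0)"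
    if i: "i < ?m" and j: "j < ?m" for i j
  proof -
    let ?t = "(i + 1) * ?p + (j + 1)"
    have le: "r \<le> ?t"
      using r(2) by simp
    have "W $$ (i,j) = ?ev (?M $$ (i,j))"
      using i j Mmat_carrier[where 'a = 'p, of r ?m e] by (simp add: W_def)
    then have "W $$ (i,j) = ?ev (coeff (fpol r ^ e) (?t - r))"
      by (simp only: Mmat_index[OF r(1) less_imp_le[OF r(2)] i j])
    also have "\<dots> = coeff (map_poly ?ev (fpol r ^ e)) (?t - r)"
      by (simp add: coeff_map_poly)
    also have "map_poly ?ev (fpol r ^ e) = (monom 1 r + 1) ^ e"
      using r(1) by (simp only: H.hom_power) (simp add: eval_last_fpol)
    finally have W: "W $$ (i,j) = coeff ((monom 1 r + 1) ^ e) (?t - r)" .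
    have "r dvd ?t - r \<longleftrightarrow> j = J i"
      using row_match_unique(1)[where 'p = 'p, OF i r(2) j] le
      unfolding J_def by (metis dvd_minus_self not_le)
    then show ?thesis
      using r(1) unfolding W by (simp only: coeff_monom_plus_1_power)
  qed
  have W_nonzero: "W $$ (i, J i) \<noteq> 0" if i: "i < ?m" for i
  proof -
    let ?t = "(i + 1) * ?p + (J i + 1)"
    note Ji = J_less[OF i]
    have "r dvd ?t"
      using row_match_unique(1)[where 'p = 'p, OF i r(2) Ji] by (simp only: J_def)
    then obtain k where k: "?t = r * k" ..
    have "k \<noteq> 0"
      using k by (metis add_is_0 mult_0_right one_neq_zero)
    \<comment> \<open>The second bound on \<open>e\<close> enters here: it forces
      \<open>k - 1 \<le> e\<close>, so the binomial coefficient is not zero for trivial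
      reasons.\<close>
    have "(i + 1) * ?p \<le> (r - 1) * ?p"
      using i by (intro mult_right_mono) auto
    then have "r * k + ?p \<le> r * ?p + (r - 1)"
      using Ji i r unfolding k[symmetric] by (simp add: diff_mult_distrib)
    then have "r * k < r * (e + 2)"
      using e(2) r by simp
    then have "k < e + 2"
      by (simp only: mult_less_cancel1)
    then have "k \<le> e + 1"
      by simp
    have "(?t - r) div r = k - 1"
      unfolding k using r by (metis diff_mult_distrib2 div_mult_self1_is_m mult.right_neutral not_gr_zero not_numeral_le_zero)
    then have "W $$ (i, J i) = of_nat (e choose (k - 1))"
      unfolding W_index[OF i Ji] by simp
    \<comment> \<open>The coefficient divides \<open>e!\<close>, which is prime to \<open>p\<close>
      because \<open>e < p\<close>.\<close>
    moreover have "\<not> ?p dvd e choose (k - 1)"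
    proof
      assume "?p dvd e choose (k - 1)"
      moreover have "(e choose (k - 1)) dvd fact e"
        using binomial_fact_lemma[of "k - 1" e] \<open>k \<le> e + 1\<close> by (metis dvd_triv_right le_diff_conv)
      ultimately have "?p dvd fact e"
        by (rule dvd_trans)
      then show False
        using prime_card[where 'a = 'p] e(1) by (simp add: prime_dvd_fact_iff)
    qed
    ultimately show ?thesis
      using of_nat_0_mod_ring_dvd by metis
  qed
  \<comment> \<open>\<open>p\<close> is invertible modulo \<open>r\<close>, so different rows below
    \<open>r - 1\<close> leave different residues.\<close>
  have J_inj: "i = i'" if i: "i < ?m" and i': "i' < ?m" and eq: "J i = J i'" for i i'
  proof -
    have "\<not> ?p dvd r"
      using r by (auto dest: dvd_imp_le)
    then have cop: "coprime r ?p"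
      using prime_card[where 'a = 'p] by (metis coprime_commute prime_imp_coprime)
    have "(i + 1) * ?p mod r < r" "(i' + 1) * ?p mod r < r"
      using r by simp_all
    then have "(i + 1) * ?p mod r = (i' + 1) * ?p mod r"
      using eq unfolding J_def by linarith
    then have "[(i + 1) * ?p = (i' + 1) * ?p] (mod r)"
      by (simp only: cong_def)
    then have "[i + 1 = i' + 1] (mod r)"
      using cop cong_mult_rcancel_nat[of ?p r] by (simp only: coprime_commute)
    then have "i + 1 = i' + 1"
      using i i' by (intro cong_less_modulus_unique_nat) auto
    then show ?thesis
      by simp
  qed
  \<comment> \<open>The inverse of a monomial matrix: transposed pattern, inverted entries.\<close>
  define X where "X = mat ?m ?m (\<lambda>(j,i). if j = J i then inverse (W $$ (i,j)) else 0)"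
  have X_carrier: "X \<in> carrier_mat ?m ?m"
    by (simp add: X_def)
  have "W * X = 1\<^sub>m ?m"
  proof (rule eq_matI)
    fix i i' assume "i < dim_row (1\<^sub>m ?m :: 'p mod_ring mat)" "i' < dim_col (1\<^sub>m ?m :: 'p mod_ring mat)"
    then have i: "i < ?m" and i': "i' < ?m" by simp_all
    have "(W * X) $$ (i,i') = (\<Sum>j<?m. W $$ (i,j) * X $$ (j,i'))"
      by (rule sum_mat_index[OF W_carrier X_carrier i i'])
    also have "\<dots> = (\<Sum>j<?m. if j = J i then W $$ (i,J i) * X $$ (J i,i') else 0)"
      by (rule sum.cong) (auto simp: W_index[OF i])
    also have "\<dots> = W $$ (i,J i) * X $$ (J i,i')"
      using J_less[OF i] by simp
    also have "\<dots> = 1\<^sub>m ?m $$ (i,i')"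
      using i i' J_less[OF i] J_inj[OF i i'] W_nonzero[OF i] by (auto simp: X_def)
    finally show "(W * X) $$ (i,i') = 1\<^sub>m ?m $$ (i,i')" .
  qed (use W_carrier X_carrier in auto)
  then have "det W * det X = 1"
    using det_mult[OF W_carrier X_carrier] by simp
  moreover assume "det ?M = 0"
  then have "det W = 0"
    by (simp add: W_def)
  ultimately show False
    by simp
qed

section \<open>Passage to the fraction field and conclusion\<close>

lemma comm_ring_hom_Fract: "comm_ring_hom (\<lambda>a::'a::idom. Fract a 1)"
  by standard (simp_all add: Zero_fract_def One_fract_def)

lemma inverse_mat_of_det_nonzero:
  fixes A :: "'a::field mat"
  assumes A: "A \<in> carrier_mat n n" and det: "det A \<noteq> 0"
  shows "\<exists>B. B \<in> carrier_mat n n \<and> B * A = 1\<^sub>m n \<and> A * B = 1\<^sub>m n"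
proof (intro exI conjI)
  let ?B = "inverse (det A) \<cdot>\<^sub>m adj_mat A"
  note adj = adj_mat[OF A]
  show "?B \<in> carrier_mat n n"
    using adj(1) by simp
  have one: "inverse (det A) \<cdot>\<^sub>m (det A \<cdot>\<^sub>m 1\<^sub>m n) = 1\<^sub>m n"
    using det by (intro eq_matI) auto
  show "?B * A = 1\<^sub>m n"
    using mult_smult_assoc_mat[OF adj(1) A, of "inverse (det A)"] adj(3) one by simp
  show "A * ?B = 1\<^sub>m n"
    using mult_smult_distrib[OF A adj(1), of "inverse (det A)"] adj(2) one by simp
qed

theorem theorem5:
  fixes r e d :: int and n :: int
  assumes B1: "(r, e, d) \<in> B0 (int CARD('p::prime_card))"
    and B2: "(r, e + 1, d) \<in> B0 (int CARD('p))"
    and n_def: "n = int CARD('p) - 1 - e"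
  shows "p_integral_mat (int CARD('p)) (Bmat (nat r)) \<and>
         p_integral_mat (int CARD('p)) (Qmat (nat r)) \<and>
         p_integral_mat (int CARD('p)) (Zmat (nat r) n) \<and>
         p_integral_mat (int CARD('p)) (Pmat (nat r)) \<and>
         (let M = to_fract_mat (Mmat (nat r) (nat d) (nat e) :: ('p mod_ring) mpol mat);
              N = to_fract_mat (Mmat (nat r) (nat d) (nat (e + 1)) :: ('p mod_ring) mpol mat);
              R = to_fract_mat (red_mat (Bmat (nat r)) * red_mat (Qmat (nat r))
                                * red_mat (Zmat (nat r) n) * red_mat (Pmat (nat r))
                                :: ('p mod_ring) mpol mat)
          in \<exists>Minv. Minv \<in> carrier_mat (nat d) (nat d) \<and>
                   Minv * M = 1\<^sub>m (nat d) \<and> M * Minv = 1\<^sub>m (nat d) \<and> Minv * N = R)"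
proof -
  let ?p = "CARD('p)" and ?m = "nat r - 1"
  have r2: "2 \<le> r" and e1: "e + 1 \<le> int ?p - 1" and rn: "r * n \<le> int ?p - 1" and d: "d = r - 1"
    and e_pos: "real_of_int (int ?p - 1) / 2 < real_of_int e"
    using B1 B2 by (auto simp: B0_def n_def)
  \<comment> \<open>Membership of \<open>(r, e+1, d)\<close> gives \<open>n >= 1\<close>; together
    with \<open>r n \<le> p - 1\<close> from \<open>(r, e, d)\<close> this sharpens the bound on
    \<open>r\<close> to \<open>r < p\<close>.\<close>
  have n1: "1 \<le> n"
    using e1 by (simp add: n_def)
  have "r * 1 \<le> r * n"
    using n1 r2 by (intro mult_left_mono) auto
  then have rp: "r < int ?p"
    using rn by linarith
  \<comment> \<open>Nonnegativity makes the conversions by \<open>nat\<close> faithful; it follows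
    from \<open>e > (p-1)/2\<close>.\<close>
  have e0: "0 \<le> e"
  proof -
    have "real ?p > 1"
      using prime_gt_1_nat[OF prime_card[where 'a = 'p]] by simp
    then show ?thesis
      using e_pos by simp
  qed
  have dm: "nat d = ?m" and e_Suc: "nat (e + 1) = Suc (nat e)"
    using d r2 e0 by auto
  have r': "2 \<le> nat r" "nat r < ?p"
    using r2 rp by linarith+
  have n': "1 \<le> n" "int (nat r) * n < int ?p"
    using n1 rn r2 by simp_all
  have e': "int (nat e) + 1 + n = int ?p"
    using e0 by (simp add: n_def)
  define M where "M = (Mmat (nat r) ?m (nat e) :: 'p mod_ring mpol mat)"
  define N where "N = (Mmat (nat r) ?m (Suc (nat e)) :: 'p mod_ring mpol mat)"
  define R where "R = (red_mat (Bmat (nat r)) * red_mat (Qmat (nat r))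
    * red_mat (Zmat (nat r) n) * red_mat (Pmat (nat r)) :: 'p mod_ring mpol mat)"
  have M: "M \<in> carrier_mat ?m ?m"
    unfolding M_def by (rule Mmat_carrier)
  have R: "R \<in> carrier_mat ?m ?m"
    using Bmat_carrier[OF r'(1)] Qmat_carrier[of "nat r"] Zmat_carrier[of "nat r" n] Pmat_carrier[of "nat r"]
    unfolding R_def red_mat_def by (intro mult_carrier_mat[of _ _ ?m]) auto
  have N: "N = M * R"
    unfolding M_def N_def R_def by (rule Mmat_Suc[OF r' n' e'])
  interpret comm_ring_hom "\<lambda>a :: 'p mod_ring mpol. Fract a 1"
    by (rule comm_ring_hom_Fract)
  have "det M \<noteq> 0"
    unfolding M_def
  proof (rule det_Mmat_nonzero[OF r'])
    show "nat e < ?p"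
      using e0 e1 by (simp add: nat_less_iff)
    \<comment> \<open>Multiplying \<open>e + 1 + n = p\<close> by \<open>r\<close> turns
      \<open>r n < p\<close> into the second bound required for the determinant.\<close>
    have "int (nat r) * int ?p = int (nat r) * (int (nat e) + 1) + int (nat r) * n"
      unfolding e'[symmetric] by (simp only: distrib_left)
    then have "int (nat r * ?p) < int (nat r * (nat e + 1) + ?p)"
      using n'(2) by (simp add: distrib_left)
    then show "nat r * ?p < nat r * (nat e + 1) + ?p"
      by (simp only: of_nat_less_iff)
  qed
  then have "Fract (det M) 1 \<noteq> 0"
    unfolding Zero_fract_def by (subst eq_fract) simp_all
  then have "det (to_fract_mat M) \<noteq> 0"
    unfolding to_fract_mat_def hom_det .
  moreover have tM: "to_fract_mat M \<in> carrier_mat ?m ?m"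
    using M by (simp add: to_fract_mat_def)
  ultimately obtain Minv where Minv: "Minv \<in> carrier_mat ?m ?m"
      "Minv * to_fract_mat M = 1\<^sub>m ?m" "to_fract_mat M * Minv = 1\<^sub>m ?m"
    using inverse_mat_of_det_nonzero by blast
  have tR: "to_fract_mat R \<in> carrier_mat ?m ?m"
    using R by (simp add: to_fract_mat_def)
  have "Minv * to_fract_mat N = Minv * (to_fract_mat M * to_fract_mat R)"
    unfolding N to_fract_mat_def by (simp only: mat_hom_mult[OF M R])
  also have "\<dots> = to_fract_mat R"
    using assoc_mult_mat[OF Minv(1) tM tR] Minv(2) tR by simp
  finally have "Minv * to_fract_mat N = to_fract_mat R" .
  then show ?thesis
    using p_integral_mats[where 'p = 'p, OF r' n'] Minv
    unfolding Let_def dm e_Suc M_def N_def R_def by blast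
qed

end
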